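(* Let $g_0$ be the canonical metric on the unit sphere $S^{2m+1}$. For all Riemannian $g_0$-natural metrics $G$ on $TS^{2m+1}$, a Hopf vector field $\bar\xi$ is $\mathfrak X$-harmonic if and only if $$2m(\alpha_1+\alpha_1')(1)+[2m(\alpha_1+\alpha_3)+\phi_1+\phi_3]'(1)=0.$$
   Context: Hopf vector fields on the unit sphere $S^{2m+1}$ with its canonical metric $g_0$ are exactly the Killing unit vector fields on $(S^{2m+1},g_0)$. Let $(M,g)$ be an $n$-dimensional Riemannian manifold with Levi-Civita connection $\nabla$. For $x\in M$ and $u,X\in T_xM$, $X^h$ and $X^v$ denote the horizontal (with respect to $\nabla$) and vertical lifts of $X$ to $(x,u)\in TM$. A $g$-natural metric $G$ on $TM$ is determined by six smooth functions $\alpha_i,\beta_i:\mathbb R^+=[0,\infty)\to\mathbb R$, $i=1,2,3$ (with $\beta_i=0$ if $n=1$): with $r^2=g(u,u)$, $G_{(x,u)}(X^h,Y^h)=(\alpha_1+\alpha_3)(r^2)g(X,Y)+(\beta_1+\beta_3)(r^2)g(X,u)g(Y,u)$, $G_{(x,u)}(X^h,Y^v)=G_{(x,u)}(X^v,Y^h)=\alpha_2(r^2)g(X,Y)+\beta_2(r^2)g(X,u)g(Y,u)$, $G_{(x,u)}(X^v,Y^v)=\alpha_1(r^2)g(X,Y)+\beta_1(r^2)g(X,u)g(Y,u)$. Put $\phi_i(t)=\alpha_i(t)+t\beta_i(t)$, $\alpha=\alpha_1(\alpha_1+\alpha_3)-\alpha_2^2$, $\phi=\phi_1(\phi_1+\phi_3)-\phi_2^2$.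 $G$ is Riemannian iff $\alpha_1,\phi_1,\alpha,\phi>0$ on $\mathbb R^+$. For $V\in\mathfrak X(M)$, regarded as a map $V:(M,g)\to(TM,G)$ with tension field $\tau(V)=\mathrm{tr}(\nabla dV)$, write $\tau(V)_p=\{\tau_h(V)(p)\}^h+\{\tau_v(V)(p)\}^v$ with $\tau_h(V)(p),\tau_v(V)(p)\in T_pM$, and put $T(V)=\alpha_2\tau_h(V)+\beta_2g(\tau_h(V),V)V+\alpha_1\tau_v(V)+\beta_1g(\tau_v(V),V)V$ (functions evaluated at $\|V\|^2$). $V$ is $\mathfrak X$-harmonic if $T(V)=0$; for compact $M$ this means that $V$ is a critical point of the energy functional restricted to vector fields. *)

theory Defs
  imports "HOL-Analysis.Analysis"
begin

section \<open>Smooth maps\<close>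

primrec Ck_on :: "nat \<Rightarrow> 'e::euclidean_space set \<Rightarrow> ('e \<Rightarrow> 'f::euclidean_space) \<Rightarrow> bool" where
  "Ck_on 0 U f \<longleftrightarrow> continuous_on U f"
| "Ck_on (Suc k) U f \<longleftrightarrow> (\<forall>x\<in>U. f differentiable (at x)) \<and>
     (\<forall>v. Ck_on k U (\<lambda>x. frechet_derivative f (at x) v))"

text \<open>Intended for open sets \<open>U\<close>.\<close>
definition smooth_on :: "'e::euclidean_space set \<Rightarrow> ('e \<Rightarrow> 'f::euclidean_space) \<Rightarrow> bool" where
  "smooth_on U f \<longleftrightarrow> (\<forall>k. Ck_on k U f)"

text \<open>Smoothness on the closed half line \<open>[0,\<infinity>)\<close>, with one-sided derivatives at \<open>0\<close>;
  \<open>d k\<close> is the \<open>k\<close>-th derivative.\<close>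
definition smooth_half_line :: "(real \<Rightarrow> real) \<Rightarrow> bool" where
  "smooth_half_line f \<longleftrightarrow> (\<exists>d :: nat \<Rightarrow> real \<Rightarrow> real. d 0 = f \<and>
     (\<forall>k. \<forall>t\<ge>0. (d k has_real_derivative d (Suc k) t) (at t within {0..})))"

section \<open>Riemannian geometry in a chart\<close>

text \<open>
  A Riemannian metric in a chart, that is, on an open set of a Euclidean space \<open>'e\<close>, is a function
  \<open>g\<close> with \<open>g x X Y\<close> the inner product of the tangent vectors \<open>X\<close>, \<open>Y\<close> at \<open>x\<close>; all tangent
  spaces are identified with \<open>'e\<close>. The formulas below are the usual coordinate expressions,
  written without indices. The inner product of \<open>'e\<close> itself only serves to name the coordinates
  \<open>z \<mapsto> i \<bullet> z\<close>, \<open>i \<in> Basis\<close>.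
\<close>

type_synonym 'e metric = "'e \<Rightarrow> 'e \<Rightarrow> 'e \<Rightarrow> real"

definition metric_deriv :: "'e::euclidean_space metric \<Rightarrow> 'e \<Rightarrow> 'e \<Rightarrow> 'e \<Rightarrow> 'e \<Rightarrow> real" where
  "metric_deriv g x Z X Y = frechet_derivative (\<lambda>y. g y X Y) (at x) Z"

text \<open>
  The Levi-Civita connection is \<open>\<nabla>\<^sub>X Y = D\<^sub>X Y + \<Gamma>(X, Y)\<close> with \<open>\<Gamma>\<close> bilinear at each point, symmetric
  (torsion-free), and compatible with the metric; \<open>levi_civita g x\<close> is \<open>\<Gamma>\<close> at \<open>x\<close>, i.e. the
  Christoffel symbols.
\<close>
definition levi_civita :: "'e::euclidean_space metric \<Rightarrow> 'e \<Rightarrow> 'e \<Rightarrow> 'e \<Rightarrow> 'e" where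
  "levi_civita g x = (THE \<Gamma>. bilinear \<Gamma> \<and> (\<forall>X Y. \<Gamma> X Y = \<Gamma> Y X) \<and>
     (\<forall>X Y Z. metric_deriv g x Z X Y = g x (\<Gamma> Z X) Y + g x X (\<Gamma> Z Y)))"

text \<open>The vector metrically dual to the covector \<open>\<omega>\<close>.\<close>
definition sharp :: "'e::euclidean_space metric \<Rightarrow> 'e \<Rightarrow> ('e \<Rightarrow> real) \<Rightarrow> 'e" where
  "sharp g x \<omega> = (THE w. \<forall>z. g x w z = \<omega> z)"

text \<open>
  The trace \<open>\<Sum>\<^sub>i\<^sub>j g\<^sup>i\<^sup>j B(e\<^sub>i, e\<^sub>j)\<close> of a bilinear map: the dual of the \<open>i\<close>-th coordinate covector
  is \<open>\<Sum>\<^sub>j g\<^sup>i\<^sup>j e\<^sub>j\<close>.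
\<close>
definition metric_trace :: "'e::euclidean_space metric \<Rightarrow> 'e \<Rightarrow> ('e \<Rightarrow> 'e \<Rightarrow> 'f::euclidean_space) \<Rightarrow> 'f" where
  "metric_trace g x B = (\<Sum>i\<in>Basis. B i (sharp g x (\<lambda>z. i \<bullet> z)))"

text \<open>The second fundamental form \<open>\<nabla>df\<close> of a map \<open>f\<close> from metric \<open>g\<close> to metric \<open>h\<close>.\<close>
definition second_fundamental_form ::
  "'e::euclidean_space metric \<Rightarrow> 'f::euclidean_space metric \<Rightarrow> ('e \<Rightarrow> 'f) \<Rightarrow> 'e \<Rightarrow> 'e \<Rightarrow> 'e \<Rightarrow> 'f" where
  "second_fundamental_form g h f x X Y =
     frechet_derivative (\<lambda>y. frechet_derivative f (at y) Y) (at x) X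
     + levi_civita h (f x) (frechet_derivative f (at x) X) (frechet_derivative f (at x) Y)
     - frechet_derivative f (at x) (levi_civita g x X Y)"

definition tension :: "'e::euclidean_space metric \<Rightarrow> 'f::euclidean_space metric \<Rightarrow> ('e \<Rightarrow> 'f) \<Rightarrow> 'e \<Rightarrow> 'f" where
  "tension g h f x = metric_trace g x (second_fundamental_form g h f x)"

section \<open>Natural metrics on the tangent bundle, in a chart\<close>

text \<open>
  A chart with values in \<open>'b\<close> induces a chart of the tangent bundle with values in \<open>'b \<times> 'b\<close>; a point
  is a pair \<open>(x, u)\<close> of a base point and a tangent vector.
\<close>

definition hor_lift :: "'b::euclidean_space metric \<Rightarrow> 'b \<times> 'b \<Rightarrow> 'b \<Rightarrow> 'b \<times> 'b" where
  "hor_lift g p X = (X, - levi_civita g (fst p) X (snd p))"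

definition ver_lift :: "'b::euclidean_space \<Rightarrow> 'b \<times> 'b" where
  "ver_lift X = (0, X)"

text \<open>The vectors \<open>X\<close>, \<open>Y\<close> with \<open>w = X\<^sup>h + Y\<^sup>v\<close>; see the lemma \<open>lift_decomposition\<close>.\<close>
definition hor_part :: "'b::euclidean_space \<times> 'b \<Rightarrow> 'b" where
  "hor_part w = fst w"

definition ver_part :: "'b::euclidean_space metric \<Rightarrow> 'b \<times> 'b \<Rightarrow> 'b \<times> 'b \<Rightarrow> 'b" where
  "ver_part g p w = snd w + levi_civita g (fst p) (fst w) (snd p)"

lemma lift_decomposition:
  "hor_lift g p X + ver_lift Y = w \<longleftrightarrow> X = hor_part w \<and> Y = ver_part g p w"
  by (cases w) (auto simp: hor_lift_def ver_lift_def hor_part_def ver_part_def)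

text \<open>
  The indices \<open>1, 2, 3\<close> of the coefficient functions \<open>\<alpha>\<^sub>i, \<beta>\<^sub>i\<close> are the first argument of \<open>\<alpha>\<close>, \<open>\<beta>\<close>.
\<close>
definition natural_metric ::
  "(nat \<Rightarrow> real \<Rightarrow> real) \<Rightarrow> (nat \<Rightarrow> real \<Rightarrow> real) \<Rightarrow> 'b::euclidean_space metric \<Rightarrow> ('b \<times> 'b) metric" where
  "natural_metric \<alpha> \<beta> g p w w' =
    (let x = fst p; u = snd p; t = g x u u;
         X = hor_part w; Y = ver_part g p w; X' = hor_part w'; Y' = ver_part g p w'
     in (\<alpha> 1 t + \<alpha> 3 t) * g x X X' + (\<beta> 1 t + \<beta> 3 t) * g x X u * g x X' u
      + \<alpha> 2 t * g x X Y' + \<beta> 2 t * g x X u * g x Y' u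
      + \<alpha> 2 t * g x Y X' + \<beta> 2 t * g x Y u * g x X' u
      + \<alpha> 1 t * g x Y Y' + \<beta> 1 t * g x Y u * g x Y' u)"

lemma
  fixes g :: "'b::euclidean_space metric"
  assumes "bilinear (g x)" and "bilinear (levi_civita g x)"
  defines "t \<equiv> \<lambda>u. g x u u"
  shows natural_metric_hor_hor:
      "natural_metric \<alpha> \<beta> g (x, u) (hor_lift g (x, u) X) (hor_lift g (x, u) Y) =
         (\<alpha> 1 (t u) + \<alpha> 3 (t u)) * g x X Y + (\<beta> 1 (t u) + \<beta> 3 (t u)) * g x X u * g x Y u"
    and natural_metric_hor_ver:
      "natural_metric \<alpha> \<beta> g (x, u) (hor_lift g (x, u) X) (ver_lift Y) =
         \<alpha> 2 (t u) * g x X Y + \<beta> 2 (t u) * g x X u * g x Y u"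
    and natural_metric_ver_hor:
      "natural_metric \<alpha> \<beta> g (x, u) (ver_lift X) (hor_lift g (x, u) Y) =
         \<alpha> 2 (t u) * g x X Y + \<beta> 2 (t u) * g x X u * g x Y u"
    and natural_metric_ver_ver:
      "natural_metric \<alpha> \<beta> g (x, u) (ver_lift X) (ver_lift Y) =
         \<alpha> 1 (t u) * g x X Y + \<beta> 1 (t u) * g x X u * g x Y u"
  using assms(1,2)
  by (simp_all add: natural_metric_def Let_def hor_lift_def ver_lift_def hor_part_def ver_part_def
      t_def bilinear_lzero bilinear_rzero)

definition phi :: "(nat \<Rightarrow> real \<Rightarrow> real) \<Rightarrow> (nat \<Rightarrow> real \<Rightarrow> real) \<Rightarrow> nat \<Rightarrow> real \<Rightarrow> real" where
  "phi \<alpha> \<beta> i t = \<alpha> i t + t * \<beta> i t"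

text \<open>The vector field \<open>T(V)\<close>, for \<open>V\<close> viewed as the map \<open>x \<mapsto> (x, V x)\<close> into the tangent bundle.\<close>
definition T_field ::
  "(nat \<Rightarrow> real \<Rightarrow> real) \<Rightarrow> (nat \<Rightarrow> real \<Rightarrow> real) \<Rightarrow> 'b::euclidean_space metric \<Rightarrow> ('b \<Rightarrow> 'b) \<Rightarrow> 'b \<Rightarrow> 'b" where
  "T_field \<alpha> \<beta> g V x =
    (let \<tau> = tension g (natural_metric \<alpha> \<beta> g) (\<lambda>y. (y, V y)) x;
         \<tau>h = hor_part \<tau>; \<tau>v = ver_part g (x, V x) \<tau>; t = g x (V x) (V x)
     in \<alpha> 2 t *\<^sub>R \<tau>h + (\<beta> 2 t * g x \<tau>h (V x)) *\<^sub>R V x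
      + \<alpha> 1 t *\<^sub>R \<tau>v + (\<beta> 1 t * g x \<tau>v (V x)) *\<^sub>R V x)"

section \<open>Submanifolds of Euclidean space\<close>

text \<open>
  \<open>M\<close> is a submanifold of a Euclidean space \<open>'a\<close>, with the induced metric. Charts are given by their
  inverses, the local parametrizations \<open>\<psi>\<close>, which are defined on open sets of a Euclidean space
  \<open>'b\<close> with \<open>DIM('b) = dim M\<close>. Tensorial notions are expressed in all local parametrizations.
\<close>

definition local_param ::
  "'a::euclidean_space set \<Rightarrow> 'b::euclidean_space set \<Rightarrow> ('b \<Rightarrow> 'a) \<Rightarrow> bool" where
  "local_param M U \<psi> \<longleftrightarrow> open U \<and> smooth_on U \<psi> \<and>
     (\<forall>x\<in>U. inj (frechet_derivative \<psi> (at x))) \<and>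
     openin (top_of_set M) (\<psi> ` U) \<and> (\<exists>\<phi>. homeomorphism U (\<psi> ` U) \<psi> \<phi>)"

definition induced_metric :: "('b::euclidean_space \<Rightarrow> 'a::euclidean_space) \<Rightarrow> 'b metric" where
  "induced_metric \<psi> x X Y = frechet_derivative \<psi> (at x) X \<bullet> frechet_derivative \<psi> (at x) Y"

text \<open>The coordinate expression of a vector field \<open>V\<close> tangent to \<open>M\<close>.\<close>
definition local_field ::
  "('b::euclidean_space \<Rightarrow> 'a::euclidean_space) \<Rightarrow> ('a \<Rightarrow> 'a) \<Rightarrow> 'b \<Rightarrow> 'b" where
  "local_field \<psi> V x = (THE w. frechet_derivative \<psi> (at x) w = V (\<psi> x))"

definition smooth_vector_field ::
  "'b::euclidean_space itself \<Rightarrow> 'a::euclidean_space set \<Rightarrow> ('a \<Rightarrow> 'a) \<Rightarrow> bool" where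
  "smooth_vector_field _ M V \<longleftrightarrow> (\<forall>U (\<psi> :: 'b \<Rightarrow> 'a). local_param M U \<psi> \<longrightarrow>
     (\<forall>x\<in>U. V (\<psi> x) \<in> range (frechet_derivative \<psi> (at x))) \<and> smooth_on U (local_field \<psi> V))"

text \<open>The Lie derivative of the metric along \<open>V\<close> vanishes.\<close>
definition killing_field ::
  "'b::euclidean_space itself \<Rightarrow> 'a::euclidean_space set \<Rightarrow> ('a \<Rightarrow> 'a) \<Rightarrow> bool" where
  "killing_field _ M V \<longleftrightarrow> smooth_vector_field TYPE('b) M V \<and>
     (\<forall>U (\<psi> :: 'b \<Rightarrow> 'a). local_param M U \<psi> \<longrightarrow> (\<forall>x\<in>U. \<forall>X Y.
        metric_deriv (induced_metric \<psi>) x (local_field \<psi> V x) X Y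
        + induced_metric \<psi> x (frechet_derivative (local_field \<psi> V) (at x) X) Y
        + induced_metric \<psi> x X (frechet_derivative (local_field \<psi> V) (at x) Y) = 0))"

definition hopf_field :: "'b::euclidean_space itself \<Rightarrow> ('a::euclidean_space \<Rightarrow> 'a) \<Rightarrow> bool" where
  "hopf_field _ V \<longleftrightarrow> killing_field TYPE('b) (sphere 0 1) V \<and> (\<forall>p\<in>sphere 0 1. norm (V p) = 1)"

text \<open>
  \<open>\<alpha>\<close>, \<open>\<beta>\<close> are the coefficients of a natural metric on the tangent bundle of \<open>M\<close> which is
  Riemannian, i.e. positive definite at each point (it is symmetric, bilinear and smooth by
  construction).
\<close>
definition riemannian_natural ::
  "'b::euclidean_space itself \<Rightarrow> 'a::euclidean_space set \<Rightarrow>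
   (nat \<Rightarrow> real \<Rightarrow> real) \<Rightarrow> (nat \<Rightarrow> real \<Rightarrow> real) \<Rightarrow> bool" where
  "riemannian_natural _ M \<alpha> \<beta> \<longleftrightarrow>
     (\<forall>i\<in>{1, 2, 3}. smooth_half_line (\<alpha> i) \<and> smooth_half_line (\<beta> i)) \<and>
     (DIM('b) = 1 \<longrightarrow> (\<forall>i\<in>{1, 2, 3}. \<forall>t\<ge>0. \<beta> i t = 0)) \<and>
     (\<forall>U (\<psi> :: 'b \<Rightarrow> 'a). local_param M U \<psi> \<longrightarrow> (\<forall>x\<in>U. \<forall>u w. w \<noteq> 0 \<longrightarrow>
        natural_metric \<alpha> \<beta> (induced_metric \<psi>) (x, u) w w > 0))"

definition X_harmonic ::
  "'b::euclidean_space itself \<Rightarrow> 'a::euclidean_space set \<Rightarrow>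
   (nat \<Rightarrow> real \<Rightarrow> real) \<Rightarrow> (nat \<Rightarrow> real \<Rightarrow> real) \<Rightarrow> ('a \<Rightarrow> 'a) \<Rightarrow> bool" where
  "X_harmonic _ M \<alpha> \<beta> V \<longleftrightarrow> (\<forall>U (\<psi> :: 'b \<Rightarrow> 'a). local_param M U \<psi> \<longrightarrow>
     (\<forall>x\<in>U. T_field \<alpha> \<beta> (induced_metric \<psi>) (local_field \<psi> V) x = 0))"

end

theory Submission
  imports Defs
begin

text \<open>
  Since \<open>T(V)\<close> is built from the coefficients of \<open>G(\<cdot>, Y\<^sup>v)\<close>, it satisfies
  \<open>g(T(V), Y) = G(\<tau>(V), Y\<^sup>v)\<close> for every \<open>Y\<close> (\<open>T_field_inner\<close>). So only the inner products
  of the tension field with vertical vectors matter, and these are given by the Koszul formula for \<open>G\<close>; the connection of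
  \<open>G\<close> itself never has to be computed. Writing \<open>A = dV(X) = X\<^sup>h + (\<nabla>\<^sub>X V)\<^sup>v\<close> and extending \<open>A\<close> and \<open>Y\<^sup>v\<close>
  as constant vectors of the chart, the contribution of the connection to \<open>G(\<nabla>dV(X, X), Y\<^sup>v)\<close> is
  \<open>A G(A, Y\<^sup>v) - Y\<^sup>v G(A, A) / 2\<close>.

  On the sphere everything is expressed in the ambient Euclidean space. In a parametrization \<open>\<psi>\<close>, the
  Gauss formula reads \<open>d\<psi>(\<Gamma>(X, Y)) = D\<^sub>X D\<^sub>Y \<psi> + g(X, Y) \<psi>\<close> (\<open>gauss_formula\<close>). If \<open>F = d\<psi>(V)\<close> is a
  Killing field of length one, then \<open>D\<^sub>X F\<close> is skew-symmetric on tangent vectors and differentiating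
  this identity in the manner of the Koszul formula determines the Hessian: the tangential part of
  \<open>D\<^sub>X D\<^sub>Y F - D\<^bsub>\<Gamma>(X, Y)\<^esub> F\<close> is \<open>- g(X, Y) F\<close> (\<open>hessian_tangential\<close>). Together with \<open>|F| = 1\<close> this yields
  \<open>\<langle>D\<^sub>X F, D\<^sub>Y F\<rangle> = g(X, Y)\<close> (\<open>dd_F_inner_dd_F\<close>), that is, \<open>|\<nabla>\<^sub>X V|\<^sup>2 = |X|\<^sup>2 - g(X, V)\<^sup>2\<close>.
  With these identities all terms of \<open>G(\<nabla>dV(X, X), Y\<^sup>v)\<close> containing \<open>\<alpha>\<^sub>2\<close>, \<open>\<beta>\<^sub>2\<close> or derivatives of
  \<open>\<psi>\<close> beyond the first cancel, and what remains is
  \<open>c\<^sub>1 |X|\<^sup>2 g(V, Y) + c\<^sub>2 g(X, V)\<^sup>2 g(V, Y) + c\<^sub>3 g(X, V) g(X, Y)\<close> with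
  \<open>c\<^sub>1 = - \<alpha>\<^sub>1 - (\<alpha>\<^sub>1 + \<alpha>\<^sub>3)' - \<alpha>\<^sub>1'\<close>, \<open>c\<^sub>2 = \<alpha>\<^sub>1' - (\<beta>\<^sub>1 + \<beta>\<^sub>3)'\<close> and \<open>c\<^sub>3 = \<alpha>\<^sub>1 - (\<beta>\<^sub>1 + \<beta>\<^sub>3)\<close> at \<open>1\<close>
  (\<open>second_fundamental_form_vertical_quadratic\<close>). Polarizing and taking the trace gives
  \<open>T(V) = ((2m+1) c\<^sub>1 + c\<^sub>2 + c\<^sub>3) V\<close>, and the scalar factor is the negative of the expression in
  the theorem. As \<open>V\<close> has no zeros, \<open>T(V)\<close> vanishes at a point exactly if the factor does. The factor
  is the same everywhere, and some chart with a nonempty domain exists (\<open>sphere_has_local_param\<close>), so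
  harmonicity is equivalent to the vanishing of the factor.
\<close>

section \<open>Directional derivatives and smooth maps\<close>

text \<open>
  The direction comes first so that iterated derivatives \<open>dd X (dd Y f)\<close> can be written without
  mentioning the point.
\<close>

definition dd :: "'e::euclidean_space \<Rightarrow> ('e \<Rightarrow> 'f::euclidean_space) \<Rightarrow> 'e \<Rightarrow> 'f" where
  "dd v f = (\<lambda>x. frechet_derivative f (at x) v)"

lemma frechet_derivative_eq_dd: "frechet_derivative f (at x) v = dd v f x"
  by (simp add: dd_def)

lemma dd_eqI: "(f has_derivative f') (at x) \<Longrightarrow> dd v f x = f' v"
  unfolding dd_def by (metis frechet_derivative_at)

lemma has_derivative_dd: "f differentiable (at x) \<Longrightarrow> (f has_derivative (\<lambda>v. dd v f x)) (at x)"
  unfolding dd_def by (simp add: frechet_derivative_works[symmetric])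

lemma linear_dd: "f differentiable (at x) \<Longrightarrow> linear (\<lambda>v. dd v f x)"
  unfolding dd_def by (simp add: linear_frechet_derivative)

lemma dd_cong_open:
  assumes "open U" "x \<in> U" "\<And>y. y \<in> U \<Longrightarrow> f y = g y" "f differentiable (at x)"
  shows "dd v f x = dd v g x"
  using dd_eqI[OF has_derivative_transform_within_open[OF has_derivative_dd[OF assms(4)] assms(1,2,3)]]
  by simp

lemma dd_inner:
  assumes "f differentiable (at x)" "g differentiable (at x)"
  shows "dd v (\<lambda>y. f y \<bullet> g y) x = f x \<bullet> dd v g x + dd v f x \<bullet> g x"
  by (rule dd_eqI[where f' = "\<lambda>v. f x \<bullet> dd v g x + dd v f x \<bullet> g x"])
    (auto intro!: has_derivative_dd assms has_derivative_inner)

lemma dd_add: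
  assumes "f differentiable (at x)" "g differentiable (at x)"
  shows "dd v (\<lambda>y. f y + g y) x = dd v f x + dd v g x"
  by (rule dd_eqI[where f' = "\<lambda>v. dd v f x + dd v g x"])
    (auto intro!: has_derivative_dd assms has_derivative_add)

lemma dd_scaleR:
  assumes "f differentiable (at x)"
  shows "dd v (\<lambda>y. c *\<^sub>R f y) x = c *\<^sub>R dd v f x"
  by (rule dd_eqI[where f' = "\<lambda>v. c *\<^sub>R dd v f x"])
    (auto intro!: has_derivative_dd assms has_derivative_scaleR_right)

lemma smooth_on_dd: "smooth_on U f \<Longrightarrow> smooth_on U (dd v f)"
  unfolding smooth_on_def dd_def by (metis Ck_on.simps(2))

lemma smooth_on_differentiable: "smooth_on U f \<Longrightarrow> x \<in> U \<Longrightarrow> f differentiable (at x)"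
  unfolding smooth_on_def by (metis Ck_on.simps(2))

lemma smooth_on_continuous_on: "smooth_on U f \<Longrightarrow> continuous_on U f"
  unfolding smooth_on_def by (metis Ck_on.simps(1))

lemma has_real_derivative_along_line:
  fixes f :: "'e::euclidean_space \<Rightarrow> real"
  assumes "f differentiable (at (a + s *\<^sub>R X))"
  shows "((\<lambda>s. f (a + s *\<^sub>R X)) has_real_derivative dd X f (a + s *\<^sub>R X)) (at s)"
proof -
  have "((\<lambda>s. f (a + s *\<^sub>R X)) has_derivative (\<lambda>h. dd (h *\<^sub>R X) f (a + s *\<^sub>R X))) (at s)"
    using has_derivative_dd[OF assms]
    by (intro has_derivative_compose[of "\<lambda>s. a + s *\<^sub>R X" _ s UNIV f]) (auto intro!: derivative_eq_intros)
  moreover have "dd (h *\<^sub>R X) f (a + s *\<^sub>R X) = dd X f (a + s *\<^sub>R X) * h" for h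
    using linear_scale[OF linear_dd[OF assms], of h X] by simp
  ultimately show ?thesis by (simp add: has_field_derivative_def)
qed

text \<open>
  The mean value theorem, applied first in the direction \<open>X\<close> and then in the direction \<open>Y\<close>. The second
  difference is symmetric in \<open>X\<close> and \<open>Y\<close>, which is what makes mixed derivatives commute.
\<close>

lemma second_difference_mean_value:
  fixes f :: "'e::euclidean_space \<Rightarrow> real"
  assumes df: "\<And>y. y \<in> U \<Longrightarrow> f differentiable (at y)"
    and ddf: "\<And>y. y \<in> U \<Longrightarrow> dd X f differentiable (at y)"
    and box: "\<And>s t. 0 \<le> s \<Longrightarrow> s \<le> e \<Longrightarrow> 0 \<le> t \<Longrightarrow> t \<le> e \<Longrightarrow> x + s *\<^sub>R X + t *\<^sub>R Y \<in> U"
    and e: "0 < e"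
  shows "\<exists>s t. 0 \<le> s \<and> s \<le> e \<and> 0 \<le> t \<and> t \<le> e \<and>
     f (x + e *\<^sub>R X + e *\<^sub>R Y) - f (x + e *\<^sub>R X) - f (x + e *\<^sub>R Y) + f x
       = e * e * dd Y (dd X f) (x + s *\<^sub>R X + t *\<^sub>R Y)"
proof -
  define h where "h s = f ((x + e *\<^sub>R Y) + s *\<^sub>R X) - f (x + s *\<^sub>R X)" for s
  have "\<exists>s>0. s < e \<and> h e - h 0
      = (e - 0) * (dd X f ((x + e *\<^sub>R Y) + s *\<^sub>R X) - dd X f (x + s *\<^sub>R X))"
  proof (rule MVT2[OF e])
    fix s assume s: "0 \<le> s" "s \<le> e"
    have "x + s *\<^sub>R X \<in> U" using box[of s 0] s e by simp
    moreover have "(x + e *\<^sub>R Y) + s *\<^sub>R X \<in> U" using box[of s e] s e by (simp add: ac_simps)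
    ultimately show "DERIV h s :> dd X f ((x + e *\<^sub>R Y) + s *\<^sub>R X) - dd X f (x + s *\<^sub>R X)"
      unfolding h_def by (intro DERIV_diff has_real_derivative_along_line df)
  qed
  then obtain s where s: "0 < s" "s < e"
    "h e - h 0 = e * (dd X f ((x + e *\<^sub>R Y) + s *\<^sub>R X) - dd X f (x + s *\<^sub>R X))" by auto
  have "\<exists>t>0. t < e \<and> dd X f ((x + s *\<^sub>R X) + e *\<^sub>R Y) - dd X f ((x + s *\<^sub>R X) + 0 *\<^sub>R Y)
      = (e - 0) * dd Y (dd X f) ((x + s *\<^sub>R X) + t *\<^sub>R Y)"
    using s by (intro MVT2[OF e] has_real_derivative_along_line ddf) (auto intro!: box)
  then obtain t where t: "0 < t" "t < e" 
    "dd X f ((x + s *\<^sub>R X) + e *\<^sub>R Y) - dd X f (x + s *\<^sub>R X) = e * dd Y (dd X f) ((x + s *\<^sub>R X) + t *\<^sub>R Y)"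
    by auto
  have eq: "x + e *\<^sub>R Y + s *\<^sub>R X = x + s *\<^sub>R X + e *\<^sub>R Y" for s by (simp add: ac_simps)
  have "h e - h 0 = f (x + e *\<^sub>R X + e *\<^sub>R Y) - f (x + e *\<^sub>R X) - f (x + e *\<^sub>R Y) + f x"
    by (simp add: h_def ac_simps)
  moreover have "h e - h 0 = e * e * dd Y (dd X f) (x + s *\<^sub>R X + t *\<^sub>R Y)"
    unfolding s(3) eq t(3) by simp
  ultimately show ?thesis using s(1,2) t(1,2) by (metis less_imp_le)
qed

lemma dd_commute_real:
  fixes f :: "'e::euclidean_space \<Rightarrow> real"
  assumes U: "open U" "x \<in> U" and f: "smooth_on U f"
  shows "dd X (dd Y f) x = dd Y (dd X f) x"
proof (rule ccontr)
  define p where "p = dd X (dd Y f)"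
  define q where "q = dd Y (dd X f)"
  assume "dd X (dd Y f) x \<noteq> dd Y (dd X f) x"
  then have \<delta>: "\<bar>p x - q x\<bar> / 2 > 0" by (simp add: p_def q_def)
  have "isCont p x" "isCont q x"
    using U f smooth_on_continuous_on smooth_on_dd unfolding p_def q_def
    by (metis continuous_on_eq_continuous_at)+
  then have "\<forall>\<^sub>F y in nhds x. y \<in> U \<and> dist (p y) (p x) < \<bar>p x - q x\<bar> / 2
      \<and> dist (q y) (q x) < \<bar>p x - q x\<bar> / 2"
    using eventually_nhds_in_open[OF U] \<delta>
    by (intro eventually_conj tendstoD[of p] tendstoD[of q] \<delta>)
      (simp_all add: isCont_def tendsto_at_iff_tendsto_nhds)
  then obtain r where r: "r > 0" and near: "\<And>y. dist y x < r \<Longrightarrow> y \<in> U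
      \<and> dist (p y) (p x) < \<bar>p x - q x\<bar> / 2 \<and> dist (q y) (q x) < \<bar>p x - q x\<bar> / 2"
    unfolding eventually_nhds_metric by blast
  \<comment> \<open>The side of the parallelogram is chosen so that it stays in the ball of radius \<open>r\<close>.\<close>
  define e where "e = r / (norm X + norm Y + 1)"
  have den: "norm X + norm Y + 1 > 0" by (intro add_nonneg_pos) auto
  then have e: "e > 0" using r by (simp add: e_def)
  have box: "dist (x + s *\<^sub>R X + t *\<^sub>R Y) x < r"
    if "0 \<le> s" "s \<le> e" "0 \<le> t" "t \<le> e" for s t
  proof -
    have "norm (s *\<^sub>R X + t *\<^sub>R Y) \<le> e * norm X + e * norm Y"
      using that by (intro norm_triangle_mono) (auto intro: mult_right_mono)
    also have "\<dots> < e * (norm X + norm Y + 1)" using e by (simp add: algebra_simps)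
    also have "\<dots> = r" using den by (simp add: e_def)
    finally show ?thesis by (simp add: dist_norm add.assoc)
  qed
  have sm: "y \<in> U \<Longrightarrow> f differentiable (at y)" "y \<in> U \<Longrightarrow> dd Z f differentiable (at y)" for y Z
    using f smooth_on_differentiable smooth_on_dd by blast+
  obtain s t where st: "0 \<le> s" "s \<le> e" "0 \<le> t" "t \<le> e"
      "f (x + e *\<^sub>R X + e *\<^sub>R Y) - f (x + e *\<^sub>R X) - f (x + e *\<^sub>R Y) + f x
       = e * e * q (x + s *\<^sub>R X + t *\<^sub>R Y)"
    unfolding q_def using second_difference_mean_value[of U f X e x Y] sm near[OF box] e by blast
  have box': "dist (x + s *\<^sub>R Y + t *\<^sub>R X) x < r"
    if "0 \<le> s" "s \<le> e" "0 \<le> t" "t \<le> e" for s t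
    using box[OF that(3,4,1,2)] by (simp add: ac_simps)
  obtain s' t' where st': "0 \<le> s'" "s' \<le> e" "0 \<le> t'" "t' \<le> e"
      "f (x + e *\<^sub>R Y + e *\<^sub>R X) - f (x + e *\<^sub>R Y) - f (x + e *\<^sub>R X) + f x
       = e * e * p (x + s' *\<^sub>R Y + t' *\<^sub>R X)"
    unfolding p_def using second_difference_mean_value[of U f Y e x X] sm near[OF box'] e by blast
  have "e * e * q (x + s *\<^sub>R X + t *\<^sub>R Y) = e * e * p (x + s' *\<^sub>R Y + t' *\<^sub>R X)"
  proof -
    have *: "x + e *\<^sub>R Y + e *\<^sub>R X = x + e *\<^sub>R X + e *\<^sub>R Y" by simp
    show ?thesis using st(5) st'(5)[unfolded *] by linarith
  qed
  then have "q (x + s *\<^sub>R X + t *\<^sub>R Y) = p (x + s' *\<^sub>R Y + t' *\<^sub>R X)" using e by simp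
  moreover have "\<bar>q (x + s *\<^sub>R X + t *\<^sub>R Y) - q x\<bar> < \<bar>p x - q x\<bar> / 2"
    using near[OF box[OF st(1-4)]] by (simp add: dist_real_def)
  moreover have "\<bar>p (x + s' *\<^sub>R Y + t' *\<^sub>R X) - p x\<bar> < \<bar>p x - q x\<bar> / 2"
    using near[OF box'[OF st'(1-4)]] by (simp add: dist_real_def)
  ultimately show False by argo
qed

lemma Ck_on_cong:
  assumes "open U" "\<And>x. x \<in> U \<Longrightarrow> f x = g x" "Ck_on k U f"
  shows "Ck_on k U g"
  using assms(2,3)
proof (induction k arbitrary: f g)
  case 0
  then show ?case using continuous_on_cong by fastforce
next
  case (Suc k)
  have "g differentiable (at x)" if "x \<in> U" for x
  proof -
    have "(f has_derivative (\<lambda>v. dd v f x)) (at x)" using Suc.prems that by (simp add: has_derivative_dd)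
    from has_derivative_transform_within_open[OF this assms(1) that Suc.prems(1)]
    show ?thesis by (rule differentiableI)
  qed
  moreover have "Ck_on k U (\<lambda>x. frechet_derivative g (at x) v)" for v
  proof (rule Suc.IH)
    show "Ck_on k U (\<lambda>x. frechet_derivative f (at x) v)" using Suc.prems by simp
    show "frechet_derivative f (at x) v = frechet_derivative g (at x) v" if "x \<in> U" for x
      using dd_cong_open[OF assms(1) that, of f g v] Suc.prems that
      by (auto simp: frechet_derivative_eq_dd)
  qed
  ultimately show ?case by simp
qed

lemma Ck_on_SucD: "Ck_on (Suc k) U f \<Longrightarrow> Ck_on k U f"
proof (induction k arbitrary: f)
  case 0
  then show ?case
    by (simp add: continuous_at_imp_continuous_on differentiable_imp_continuous_within)
next
  case (Suc k)
  have "\<forall>v. Ck_on k U (\<lambda>x. frechet_derivative f (at x) v)"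
    using Suc.IH Ck_on.simps(2)[of "Suc k" U f] Suc.prems by blast
  with Suc.prems show ?case by (subst Ck_on.simps(2)) simp
qed

lemma Ck_on_linear:
  fixes L :: "'b::euclidean_space \<Rightarrow> 'c::euclidean_space" and f :: "'a::euclidean_space \<Rightarrow> 'b"
  assumes U: "open U" and L: "linear L" and "Ck_on k U f"
  shows "Ck_on k U (\<lambda>x. L (f x))"
  using assms(3)
proof (induction k arbitrary: f)
  case 0
  then show ?case
    using L by (simp add: linear_conv_bounded_linear bounded_linear.continuous_on)
next
  case (Suc k)
  have der: "((\<lambda>x. L (f x)) has_derivative (\<lambda>v. L (dd v f x))) (at x)" if "x \<in> U" for x
    using Suc.prems that L unfolding linear_conv_bounded_linear
    by (intro bounded_linear.has_derivative[of L] has_derivative_dd) simp_all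
  show ?case
  proof (simp, intro conjI ballI allI)
    show "(\<lambda>x. L (f x)) differentiable (at x)" if "x \<in> U" for x
      using der[OF that] differentiableI by blast
    show "Ck_on k U (\<lambda>x. frechet_derivative (\<lambda>x. L (f x)) (at x) v)" for v
    proof (rule Ck_on_cong[OF U])
      show "Ck_on k U (\<lambda>x. L (dd v f x))" using Suc unfolding dd_def by simp
      show "L (dd v f x) = frechet_derivative (\<lambda>x. L (f x)) (at x) v" if "x \<in> U" for x
        using dd_eqI[OF der[OF that]] by (simp add: frechet_derivative_eq_dd)
    qed
  qed
qed

lemma Ck_on_add:
  assumes U: "open U" and "Ck_on k U f" "Ck_on k U g"
  shows "Ck_on k U (\<lambda>x. f x + g x)"
  using assms(2,3)
proof (induction k arbitrary: f g)
  case 0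
  then show ?case by (simp add: continuous_on_add)
next
  case (Suc k)
  show ?case
  proof (simp, intro conjI ballI allI)
    show "(\<lambda>x. f x + g x) differentiable (at x)" if "x \<in> U" for x
      using Suc.prems that by simp
    show "Ck_on k U (\<lambda>x. frechet_derivative (\<lambda>x. f x + g x) (at x) v)" for v
    proof (rule Ck_on_cong[OF U])
      show "Ck_on k U (\<lambda>x. dd v f x + dd v g x)" using Suc unfolding dd_def by simp
      show "dd v f x + dd v g x = frechet_derivative (\<lambda>x. f x + g x) (at x) v" if "x \<in> U" for x
        using Suc.prems that by (simp add: frechet_derivative_eq_dd dd_add)
    qed
  qed
qed

lemma Ck_on_scaleR:
  assumes U: "open U" and "Ck_on k U f" "Ck_on k U g"
  shows "Ck_on k U (\<lambda>x. f x *\<^sub>R g x)"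
  using assms(2,3)
proof (induction k arbitrary: f g)
  case 0
  then show ?case by (simp add: continuous_on_scaleR)
next
  case (Suc k)
  have der: "((\<lambda>x. f x *\<^sub>R g x) has_derivative (\<lambda>v. f x *\<^sub>R dd v g x + dd v f x *\<^sub>R g x)) (at x)"
    if "x \<in> U" for x
    using Suc.prems that by (auto intro!: has_derivative_scaleR has_derivative_dd)
  show ?case
  proof (simp, intro conjI ballI allI)
    show "(\<lambda>x. f x *\<^sub>R g x) differentiable (at x)" if "x \<in> U" for x
      using der[OF that] differentiableI by blast
    show "Ck_on k U (\<lambda>x. frechet_derivative (\<lambda>x. f x *\<^sub>R g x) (at x) v)" for v
    proof (rule Ck_on_cong[OF U])
      show "Ck_on k U (\<lambda>x. f x *\<^sub>R dd v g x + dd v f x *\<^sub>R g x)"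
        using Suc Ck_on_SucD[OF Suc.prems(1)] Ck_on_SucD[OF Suc.prems(2)]
        unfolding dd_def by (intro Ck_on_add[OF U] Suc.IH) auto
      show "f x *\<^sub>R dd v g x + dd v f x *\<^sub>R g x
          = frechet_derivative (\<lambda>x. f x *\<^sub>R g x) (at x) v" if "x \<in> U" for x
        using dd_eqI[OF der[OF that]] by (simp add: frechet_derivative_eq_dd)
    qed
  qed
qed

lemma Ck_on_const: "Ck_on k U (\<lambda>x. c)"
  by (induction k arbitrary: c) auto

lemma Ck_on_ident: "Ck_on k U (\<lambda>x. x)"
  by (cases k) (auto intro: Ck_on_const)

lemma dd_commute:
  assumes U: "open U" "x \<in> U" and f: "smooth_on U f"
  shows "dd X (dd Y f) x = dd Y (dd X f) x"
proof (rule euclidean_eqI)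
  fix i :: 'b assume "i \<in> Basis"
  have fi: "smooth_on U (\<lambda>x. f x \<bullet> i)"
    using f Ck_on_linear[OF U(1), of "\<lambda>v. v \<bullet> i" _ f]
    unfolding smooth_on_def by (simp add: bounded_linear_inner_left bounded_linear.linear)
  have d1: "dd Z (\<lambda>x. f x \<bullet> i) y = dd Z f y \<bullet> i" if "y \<in> U" for y Z
    using smooth_on_differentiable[OF f that] dd_inner[of f y "\<lambda>_. i" Z]
    by (simp add: dd_def)
  have d2: "dd W (dd Z (\<lambda>x. f x \<bullet> i)) x = dd W (dd Z f) x \<bullet> i" for W Z
  proof -
    have "dd W (dd Z (\<lambda>x. f x \<bullet> i)) x = dd W (\<lambda>x. dd Z f x \<bullet> i) x"
      using U d1 smooth_on_differentiable[OF smooth_on_dd[OF fi]] by (intro dd_cong_open) auto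
    also have "\<dots> = dd W (dd Z f) x \<bullet> i"
      using smooth_on_differentiable[OF smooth_on_dd[OF f] U(2)] dd_inner[of "dd Z f" x "\<lambda>_. i" W]
      by (simp add: dd_def)
    finally show ?thesis .
  qed
  show "dd X (dd Y f) x \<bullet> i = dd Y (dd X f) x \<bullet> i"
    using dd_commute_real[OF U fi] d2 by metis
qed

text \<open>
  The product rule for a family of linear maps \<open>L x\<close> applied to a moving vector. For families such as
  \<open>L x v = dd v \<psi> x\<close> it differentiates expressions in which both the base point and the tangent vector
  vary, as happens along vector fields and on the tangent bundle.
\<close>

lemma has_derivative_family:
  fixes L :: "'e::euclidean_space \<Rightarrow> 'e \<Rightarrow> 'f::euclidean_space"
    and y :: "'z::real_normed_vector \<Rightarrow> 'e"
  assumes U: "open U" "y z \<in> U"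
    and lin: "\<And>x. x \<in> U \<Longrightarrow> linear (L x)"
    and diff: "\<And>e. (\<lambda>x. L x e) differentiable (at (y z))"
    and dy: "(y has_derivative y') (at z)" and du: "(u has_derivative u') (at z)"
  shows "((\<lambda>z. L (y z) (u z)) has_derivative
      (\<lambda>h. dd (y' h) (\<lambda>x. L x (u z)) (y z) + L (y z) (u' h))) (at z)"
proof -
  \<comment> \<open>Expanding in a basis leaves a finite sum of products of real functions with fixed maps.\<close>
  have exp: "L x v = (\<Sum>i\<in>Basis. (v \<bullet> i) *\<^sub>R L x i)" if "x \<in> U" for x v
    using linear_sum[OF lin[OF that], of "\<lambda>i. (v \<bullet> i) *\<^sub>R i" Basis] linear_scale[OF lin[OF that]]
    by (simp add: euclidean_representation)
  have near: "\<forall>\<^sub>F w in nhds z. y w \<in> U"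
    using has_derivative_continuous[OF dy] U
    by (intro topological_tendstoD[of y "y z"]) (auto simp: isCont_def tendsto_at_iff_tendsto_nhds)
  have "((\<lambda>w. \<Sum>i\<in>Basis. (u w \<bullet> i) *\<^sub>R L (y w) i) has_derivative
      (\<lambda>h. \<Sum>i\<in>Basis. (u z \<bullet> i) *\<^sub>R dd (y' h) (\<lambda>x. L x i) (y z) + (u' h \<bullet> i) *\<^sub>R L (y z) i)) (at z)"
    by (intro has_derivative_sum has_derivative_scaleR
        has_derivative_compose[OF dy has_derivative_dd[OF diff]])
      (auto intro!: derivative_eq_intros du)
  moreover have "(\<Sum>i\<in>Basis. (u z \<bullet> i) *\<^sub>R dd (y' h) (\<lambda>x. L x i) (y z) + (u' h \<bullet> i) *\<^sub>R L (y z) i)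
      = dd (y' h) (\<lambda>x. L x (u z)) (y z) + L (y z) (u' h)" for h
  proof -
    have "((\<lambda>x. \<Sum>i\<in>Basis. (u z \<bullet> i) *\<^sub>R L x i) has_derivative
        (\<lambda>h. \<Sum>i\<in>Basis. (u z \<bullet> i) *\<^sub>R dd h (\<lambda>x. L x i) (y z))) (at (y z))"
      by (intro has_derivative_sum has_derivative_scaleR_right has_derivative_dd diff)
    from has_derivative_transform_within_open[OF this U, of "\<lambda>x. L x (u z)"]
    have "dd (y' h) (\<lambda>x. L x (u z)) (y z) = (\<Sum>i\<in>Basis. (u z \<bullet> i) *\<^sub>R dd (y' h) (\<lambda>x. L x i) (y z))"
      by (intro dd_eqI) (use exp[symmetric] in auto)
    then show ?thesis by (simp add: sum.distrib exp[OF U(2), of "u' h", symmetric])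
  qed
  moreover have "\<forall>\<^sub>F w in at z. (\<Sum>i\<in>Basis. (u w \<bullet> i) *\<^sub>R L (y w) i) = L (y w) (u w)"
    using near exp[symmetric] by (auto elim!: eventually_mono simp: eventually_at_filter)
  ultimately show ?thesis
    using exp[OF U(2), of "u z", symmetric]
    by (simp add: has_derivative_transform_eventually)
qed

section \<open>The Levi-Civita connection and traces\<close>

text \<open>
  This is what makes the definite descriptions in \<open>levi_civita\<close> and \<open>sharp\<close> well defined.
\<close>

lemma positive_form_represents:
  fixes g :: "'e::euclidean_space \<Rightarrow> 'e \<Rightarrow> real"
  assumes bil: "bilinear g" and pos: "\<And>w. w \<noteq> 0 \<Longrightarrow> g w w > 0" and \<omega>: "linear \<omega>"
  shows "\<exists>!w. \<forall>z. g w z = \<omega> z"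
proof -
  define T where "T w = (\<Sum>i\<in>Basis. g w i *\<^sub>R i)" for w
  have T_inner: "T w \<bullet> z = g w z" for w z
  proof -
    have lin: "linear (g w)" using bil by (simp add: bilinear_def)
    have "g w z = g w (\<Sum>i\<in>Basis. (z \<bullet> i) *\<^sub>R i)" by (simp add: euclidean_representation)
    also have "\<dots> = (\<Sum>i\<in>Basis. (z \<bullet> i) * g w i)"
      by (simp add: linear_sum[OF lin] linear_scale[OF lin])
    also have "\<dots> = T w \<bullet> z"
      by (simp add: T_def inner_sum_left inner_commute[of z] mult.commute)
    finally show ?thesis by simp
  qed
  have "linear T"
    unfolding T_def
    by (rule linearI) (simp_all add: bilinear_ladd[OF bil] bilinear_lmul[OF bil]
        scaleR_add_left sum.distrib scaleR_sum_right)
  moreover have "inj T"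
  proof (subst linear_injective_0[OF \<open>linear T\<close>], intro allI impI)
    fix w assume "T w = 0"
    then have "g w w = 0" using T_inner[of w w] by simp
    then show "w = 0" using pos[of w] by fastforce
  qed
  ultimately have "surj T" by (rule linear_inj_imp_surj)
  then obtain w where "T w = (\<Sum>i\<in>Basis. \<omega> i *\<^sub>R i)" by (metis surjD)
  then have "g w z = \<omega> z" for z
  proof -
    assume "T w = (\<Sum>i\<in>Basis. \<omega> i *\<^sub>R i)"
    then have "g w z = (\<Sum>i\<in>Basis. \<omega> i *\<^sub>R i) \<bullet> z" using T_inner[of w z] by simp
    also have "\<dots> = (\<Sum>i\<in>Basis. (z \<bullet> i) *\<^sub>R \<omega> i)"
      by (simp add: inner_sum_left inner_commute[of z] mult.commute)
    also have "\<dots> = \<omega> (\<Sum>i\<in>Basis. (z \<bullet> i) *\<^sub>R i)"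
      by (simp only: linear_sum[OF \<omega>] linear_scale[OF \<omega>])
    also have "\<dots> = \<omega> z" by (simp add: euclidean_representation)
    finally show ?thesis .
  qed
  moreover have "w' = w" if "\<forall>z. g w' z = \<omega> z" "\<forall>z. g w z = \<omega> z" for w w'
  proof (rule ccontr)
    assume "w' \<noteq> w"
    then show False
      using pos[of "w' - w"] that bilinear_lsub[OF bil, of w' w "w' - w"] by simp
  qed
  ultimately show ?thesis by blast
qed

lemma metric_deriv_eq_dd: "metric_deriv g x Z X Y = dd Z (\<lambda>y. g y X Y) x"
  by (simp add: metric_deriv_def dd_def)

context
  fixes g :: "'e::euclidean_space metric" and S :: "'e set" and x :: 'e
  assumes S: "open S" "x \<in> S"
    and bil: "\<And>y. y \<in> S \<Longrightarrow> bilinear (g y)"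
    and sym: "\<And>y X Y. y \<in> S \<Longrightarrow> g y X Y = g y Y X"
    and pos: "\<And>w. w \<noteq> 0 \<Longrightarrow> g x w w > 0"
    and diff: "\<And>X Y. (\<lambda>y. g y X Y) differentiable (at x)"
begin

lemma metric_deriv_add:
  "metric_deriv g x (Z + Z') X Y = metric_deriv g x Z X Y + metric_deriv g x Z' X Y"
  "metric_deriv g x Z (X + X') Y = metric_deriv g x Z X Y + metric_deriv g x Z X' Y"
  "metric_deriv g x Z X (Y + Y') = metric_deriv g x Z X Y + metric_deriv g x Z X Y'"
proof -
  show "metric_deriv g x (Z + Z') X Y = metric_deriv g x Z X Y + metric_deriv g x Z' X Y"
    unfolding metric_deriv_eq_dd by (rule linear_add[OF linear_dd[OF diff]])
  show "metric_deriv g x Z (X + X') Y = metric_deriv g x Z X Y + metric_deriv g x Z X' Y"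
    unfolding metric_deriv_eq_dd dd_add[OF diff diff, symmetric]
    by (rule dd_cong_open[OF S]) (auto simp: bil bilinear_ladd diff)
  show "metric_deriv g x Z X (Y + Y') = metric_deriv g x Z X Y + metric_deriv g x Z X Y'"
    unfolding metric_deriv_eq_dd dd_add[OF diff diff, symmetric]
    by (rule dd_cong_open[OF S]) (auto simp: bil bilinear_radd diff)
qed

lemma metric_deriv_scaleR:
  "metric_deriv g x (c *\<^sub>R Z) X Y = c * metric_deriv g x Z X Y"
  "metric_deriv g x Z (c *\<^sub>R X) Y = c * metric_deriv g x Z X Y"
  "metric_deriv g x Z X (c *\<^sub>R Y) = c * metric_deriv g x Z X Y"
proof -
  show "metric_deriv g x (c *\<^sub>R Z) X Y = c * metric_deriv g x Z X Y"
    unfolding metric_deriv_eq_dd using linear_scale[OF linear_dd[OF diff]] by auto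
  show "metric_deriv g x Z (c *\<^sub>R X) Y = c * metric_deriv g x Z X Y"
    unfolding metric_deriv_eq_dd real_scaleR_def[symmetric] dd_scaleR[OF diff, symmetric]
    by (rule dd_cong_open[OF S]) (auto simp: bil bilinear_lmul diff)
  show "metric_deriv g x Z X (c *\<^sub>R Y) = c * metric_deriv g x Z X Y"
    unfolding metric_deriv_eq_dd real_scaleR_def[symmetric] dd_scaleR[OF diff, symmetric]
    by (rule dd_cong_open[OF S]) (auto simp: bil bilinear_rmul diff)
qed

lemma metric_deriv_sym: "metric_deriv g x Z X Y = metric_deriv g x Z Y X"
  unfolding metric_deriv_eq_dd by (rule dd_cong_open[OF S]) (auto simp: sym diff)

text \<open>
  The fundamental theorem of Riemannian geometry at a point: cyclically adding the compatibility
  conditions forces the Koszul formula, and the bilinear map represented by its right-hand side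
  has the required properties. Only the first derivatives of \<open>g\<close> at \<open>x\<close> enter.
\<close>

lemma levi_civita_koszul:
  defines "koszul X Y Z \<equiv>
    (metric_deriv g x X Y Z + metric_deriv g x Y X Z - metric_deriv g x Z X Y) / 2"
  shows "bilinear (levi_civita g x)" and "levi_civita g x X Y = levi_civita g x Y X"
    and "g x (levi_civita g x X Y) Z = koszul X Y Z"
proof -
  note gx = bil[OF S(2)]
  have nondeg: "w = w'" if "\<And>z. g x w z = g x w' z" for w w'
    using pos[of "w - w'"] that bilinear_lsub[OF gx, of w w' "w - w'"] by fastforce
  have "linear (koszul X Y)" for X Y
    unfolding koszul_def
    by (rule linearI) (simp_all add: metric_deriv_add metric_deriv_scaleR field_simps)
  from positive_form_represents[OF gx pos this]
  have "\<exists>\<Gamma>. \<forall>X Y Z. g x (\<Gamma> X Y) Z = koszul X Y Z" by metis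
  then obtain \<Gamma> where \<Gamma>: "\<And>X Y Z. g x (\<Gamma> X Y) Z = koszul X Y Z" by blast
  have \<Gamma>_sym: "\<Gamma> X Y = \<Gamma> Y X" for X Y
    by (rule nondeg) (simp add: \<Gamma> koszul_def metric_deriv_sym[of _ X Y])
  have lin: "linear (\<Gamma> X)" for X
    by (rule linearI; rule nondeg)
      (simp_all add: \<Gamma> bilinear_ladd[OF gx] bilinear_lmul[OF gx] koszul_def metric_deriv_add
        metric_deriv_scaleR field_simps)
  have \<Gamma>_bil: "bilinear \<Gamma>"
  proof -
    have "(\<lambda>X. \<Gamma> X Y) = \<Gamma> Y" for Y by (rule ext) (rule \<Gamma>_sym)
    then show ?thesis unfolding bilinear_def using lin by metis
  qed
  have "levi_civita g x = \<Gamma>"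
    unfolding levi_civita_def
  proof (rule the_equality, intro conjI allI)
    show "metric_deriv g x Z X Y = g x (\<Gamma> Z X) Y + g x X (\<Gamma> Z Y)" for X Y Z
      unfolding sym[OF S(2), of X "\<Gamma> Z Y"] \<Gamma> koszul_def
      by (simp add: metric_deriv_sym[of _ Y X] metric_deriv_sym[of _ Y Z] metric_deriv_sym[of _ X Z] field_simps)
  next
    fix \<Gamma>' assume *: "bilinear \<Gamma>' \<and> (\<forall>X Y. \<Gamma>' X Y = \<Gamma>' Y X) \<and>
       (\<forall>X Y Z. metric_deriv g x Z X Y = g x (\<Gamma>' Z X) Y + g x X (\<Gamma>' Z Y))"
    show "\<Gamma>' = \<Gamma>"
    proof (intro ext nondeg)
      fix X Y Z
      have md: "metric_deriv g x Z X Y = g x (\<Gamma>' Z X) Y + g x (\<Gamma>' Z Y) X" for X Y Z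
        using * sym[OF S(2)] by metis
      have s: "\<Gamma>' Y X = \<Gamma>' X Y" "\<Gamma>' Z X = \<Gamma>' X Z" "\<Gamma>' Z Y = \<Gamma>' Y Z" using * by metis+
      show "g x (\<Gamma>' X Y) Z = g x (\<Gamma> X Y) Z"
        unfolding \<Gamma> koszul_def md by (simp add: s)
    qed
  qed (use \<Gamma>_bil \<Gamma>_sym in auto)
  then show "bilinear (levi_civita g x)" "levi_civita g x X Y = levi_civita g x Y X"
    "g x (levi_civita g x X Y) Z = koszul X Y Z"
    using \<Gamma>_bil \<Gamma>_sym \<Gamma> by auto
qed

end

lemma sharp_works:
  assumes "bilinear (g x)" "\<And>w. w \<noteq> 0 \<Longrightarrow> g x w w > 0" "linear \<omega>"
  shows "g x (sharp g x \<omega>) z = \<omega> z"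
  using theI'[OF positive_form_represents[OF assms]] unfolding sharp_def by blast

lemma metric_trace_linear:
  fixes B B' :: "'b::euclidean_space \<Rightarrow> 'b \<Rightarrow> real"
  shows "metric_trace g x (\<lambda>X Y. B X Y + B' X Y) = metric_trace g x B + metric_trace g x B'"
    and "metric_trace g x (\<lambda>X Y. c * B X Y) = c * metric_trace g x B"
  by (simp_all add: metric_trace_def sum.distrib sum_distrib_left)

text \<open>
  Traces are taken with respect to the coordinate basis and its metric dual, so no orthonormal frame
  has to be chosen; both values follow from \<open>g x (sharp g x (\<lambda>z. i \<bullet> z)) z = i \<bullet> z\<close>.
\<close>

lemma metric_trace_inner:
  fixes g :: "'b::euclidean_space metric"
  assumes bil: "bilinear (g x)" and pos: "\<And>w. w \<noteq> 0 \<Longrightarrow> g x w w > 0"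
    and sym: "\<And>X Y. g x X Y = g x Y X"
  shows "metric_trace g x (\<lambda>X Y. g x X A * g x Y C) = g x A C"
    and "metric_trace g x (g x) = real DIM('b)"
proof -
  have sharp: "g x (sharp g x (\<lambda>z. i \<bullet> z)) z = i \<bullet> z" for i z
    by (rule sharp_works[where g = g and x = x, OF bil pos]) (auto intro: bounded_linear.linear bounded_linear_inner_right)
  have "metric_trace g x (\<lambda>X Y. g x X A * g x Y C) = (\<Sum>i\<in>Basis. (C \<bullet> i) * g x i A)"
    by (simp add: metric_trace_def sharp inner_commute mult.commute)
  also have "\<dots> = g x (\<Sum>i\<in>Basis. (C \<bullet> i) *\<^sub>R i) A"
  proof -
    have lin: "linear (\<lambda>X. g x X A)" using bil by (simp add: bilinear_def)
    show ?thesis by (simp add: linear_sum[OF lin] linear_scale[OF lin])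
  qed
  also have "\<dots> = g x C A" by (simp add: euclidean_representation)
  finally show "metric_trace g x (\<lambda>X Y. g x X A * g x Y C) = g x A C" using sym by simp
  have "g x i (sharp g x (\<lambda>z. i \<bullet> z)) = 1" if "i \<in> Basis" for i :: 'b
    using that sharp[of i i] sym by simp
  then show "metric_trace g x (g x) = real DIM('b)" by (simp add: metric_trace_def)
qed

section \<open>Charts of the unit sphere\<close>

locale sphere_chart =
  fixes U :: "'b::euclidean_space set" and \<psi> :: "'b \<Rightarrow> 'a::euclidean_space"
  assumes chart: "local_param (sphere 0 1) U \<psi>" and dims: "DIM('a) = DIM('b) + 1"
begin

lemma open_U: "open U" and smooth: "smooth_on U \<psi>"
  and inj: "x \<in> U \<Longrightarrow> inj (\<lambda>v. dd v \<psi> x)"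
  using chart unfolding local_param_def dd_def by auto

lemma on_sphere:
  assumes "x \<in> U"
  shows "\<psi> x \<bullet> \<psi> x = 1"
proof -
  have "\<psi> ` U \<subseteq> sphere 0 1"
    using chart unfolding local_param_def by (auto dest!: openin_imp_subset)
  then have "norm (\<psi> x) = 1" using assms by auto
  then show ?thesis by (simp add: dot_square_norm)
qed

lemma diff_param:
  assumes "x \<in> U"
  shows "\<psi> differentiable (at x)" "dd X \<psi> differentiable (at x)"
    "dd X (dd Y \<psi>) differentiable (at x)"
  using assms smooth smooth_on_dd smooth_on_differentiable by blast+

lemma dd_commute_param:
  assumes "x \<in> U"
  shows "dd X (dd Y \<psi>) x = dd Y (dd X \<psi>) x"
    "dd X (dd Y (dd u \<psi>)) x = dd Y (dd X (dd u \<psi>)) x"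
  using dd_commute[OF open_U assms] smooth smooth_on_dd by blast+

lemma linear_param:
  assumes x: "x \<in> U"
  shows "linear (\<lambda>v. dd v \<psi> x)" "linear (\<lambda>v. dd X (dd v \<psi>) x)" "linear (\<lambda>v. dd v (dd X \<psi>) x)"
proof -
  show *: "linear (\<lambda>v. dd v \<psi> x)" and **: "linear (\<lambda>v. dd v (dd X \<psi>) x)" for X
    using linear_dd diff_param[OF x] by blast+
  show "linear (\<lambda>v. dd X (dd v \<psi>) x)"
    using ** by (simp add: dd_commute_param(1)[OF x, of X])
qed

lemma normal_tangent:
  assumes x: "x \<in> U"
  shows "\<psi> x \<bullet> dd X \<psi> x = 0"
proof -
  have "dd X (\<lambda>y. \<psi> y \<bullet> \<psi> y) x = dd X (\<lambda>y. 1) x"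
    using x diff_param[OF x] by (intro dd_cong_open[OF open_U x]) (auto simp: on_sphere)
  then show ?thesis
    using dd_inner[OF diff_param(1)[OF x] diff_param(1)[OF x], of X]
    by (simp add: dd_def inner_commute)
qed

lemma normal_second_derivative:
  assumes x: "x \<in> U"
  shows "\<psi> x \<bullet> dd X (dd Y \<psi>) x = - (dd X \<psi> x \<bullet> dd Y \<psi> x)"
proof -
  have "dd X (\<lambda>y. \<psi> y \<bullet> dd Y \<psi> y) x = dd X (\<lambda>y. 0) x"
    using x diff_param[OF x] by (intro dd_cong_open[OF open_U x]) (auto simp: normal_tangent)
  then show ?thesis
    using dd_inner[OF diff_param(1)[OF x] diff_param(2)[OF x], of X Y] by (simp add: dd_def)
qed

text \<open>
  By dimension: an injective linear map into the hyperplane normal to \<open>\<psi> x\<close> is onto. This is where the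
  codimension of the sphere enters.
\<close>

lemma tangent_space:
  assumes x: "x \<in> U"
  shows "range (\<lambda>v. dd v \<psi> x) = {w. \<psi> x \<bullet> w = 0}"
proof (rule subspace_dim_equal)
  have "\<psi> x \<noteq> 0" using on_sphere[OF x] by auto
  then have "dim {w. \<psi> x \<bullet> w = 0} = DIM('b)" using dim_hyperplane[of "\<psi> x"] dims by simp
  moreover have "dim (range (\<lambda>v. dd v \<psi> x)) = DIM('b)"
    using dim_image_eq[OF linear_param(1)[OF x], of UNIV] inj[OF x] by simp
  ultimately show "dim {w. \<psi> x \<bullet> w = 0} \<le> dim (range (\<lambda>v. dd v \<psi> x))" by simp
qed (auto simp: normal_tangent x subspace_hyperplane linear_subspace_image linear_param)

abbreviation g :: "'b metric" where "g \<equiv> induced_metric \<psi>"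
abbreviation \<Gamma> :: "'b \<Rightarrow> 'b \<Rightarrow> 'b \<Rightarrow> 'b" where "\<Gamma> \<equiv> levi_civita (induced_metric \<psi>)"

lemma g_eq: "g x X Y = dd X \<psi> x \<bullet> dd Y \<psi> x"
  by (simp add: induced_metric_def dd_def)

lemma metric_deriv_g:
  assumes x: "x \<in> U"
  shows "metric_deriv g x Z X Y = dd Z (dd X \<psi>) x \<bullet> dd Y \<psi> x + dd X \<psi> x \<bullet> dd Z (dd Y \<psi>) x"
  unfolding metric_deriv_eq_dd g_eq
  using dd_inner[OF diff_param(2)[OF x] diff_param(2)[OF x], of Z X Y] by simp

lemma g_metric:
  assumes "x \<in> U"
  shows "bilinear (g x)" "g x X Y = g x Y X" "w \<noteq> 0 \<Longrightarrow> g x w w > 0"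
    "(\<lambda>y. g y X Y) differentiable (at x)"
proof -
  show "bilinear (g x)"
    unfolding bilinear_def g_eq
    using linear_compose[OF linear_param(1)[OF assms], of "\<lambda>z. z \<bullet> _"]
      linear_compose[OF linear_param(1)[OF assms], of "\<lambda>z. _ \<bullet> z"]
    by (auto simp: o_def intro!: bounded_linear.linear[OF bounded_linear_inner_left]
      bounded_linear.linear[OF bounded_linear_inner_right])
  show "g x X Y = g x Y X" by (simp add: g_eq inner_commute)
  show "w \<noteq> 0 \<Longrightarrow> g x w w > 0"
    using inj[OF assms] linear_injective_0[OF linear_param(1)[OF assms]] by (auto simp: g_eq)
  show "(\<lambda>y. g y X Y) differentiable (at x)"
    unfolding g_eq by (intro differentiable_inner diff_param assms)
qed

lemmas levi_civita_g = levi_civita_koszul[OF open_U _ g_metric(1) g_metric(2) g_metric(3) g_metric(4)]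

lemma bilinear_\<Gamma>: "x \<in> U \<Longrightarrow> bilinear (\<Gamma> x)"
  and \<Gamma>_commute: "x \<in> U \<Longrightarrow> \<Gamma> x X Y = \<Gamma> x Y X"
  by (rule levi_civita_g; simp)+

text \<open>
  The Koszul formula says that \<open>d\<psi>(\<Gamma>(X, Y))\<close> and \<open>D\<^sub>X D\<^sub>Y \<psi>\<close> have the same tangential part; the normal
  part of the latter is \<open>- g(X, Y) \<psi>\<close> because \<open>|\<psi>| = 1\<close>.
\<close>

lemma gauss_formula:
  assumes x: "x \<in> U"
  shows "dd (\<Gamma> x X Y) \<psi> x = dd X (dd Y \<psi>) x + (dd X \<psi> x \<bullet> dd Y \<psi> x) *\<^sub>R \<psi> x"
proof -
  have tan: "(dd (\<Gamma> x X Y) \<psi> x - dd X (dd Y \<psi>) x) \<bullet> dd Z \<psi> x = 0" for Z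
  proof -
    have "g x (\<Gamma> x X Y) Z
        = (metric_deriv g x X Y Z + metric_deriv g x Y X Z - metric_deriv g x Z X Y) / 2"
      by (rule levi_civita_g(3)) (use x in simp_all)
    then show ?thesis
      unfolding metric_deriv_g[OF x] g_eq
      by (simp add: dd_commute_param(1)[OF x, of Y X] dd_commute_param(1)[OF x, of Z]
          inner_diff_right inner_commute[of _ "dd Z \<psi> x"] inner_commute[of "dd Y \<psi> x"])
  qed
  define w where "w = dd (\<Gamma> x X Y) \<psi> x - dd X (dd Y \<psi>) x - (dd X \<psi> x \<bullet> dd Y \<psi> x) *\<^sub>R \<psi> x"
  have "\<psi> x \<bullet> w = 0"
    unfolding w_def
    by (simp add: inner_diff_right normal_tangent normal_second_derivative on_sphere x)
  then obtain Z where Z: "w = dd Z \<psi> x" using tangent_space[OF x] by blast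
  have "w \<bullet> dd Z \<psi> x = 0"
    using tan[of Z] normal_tangent[OF x, of Z] by (simp add: w_def inner_diff_left)
  then have "w = 0" using Z by simp
  then show ?thesis by (simp add: w_def algebra_simps)
qed

end

section \<open>Hopf fields in a chart\<close>

locale hopf_chart = sphere_chart U \<psi>
  for U :: "'b::euclidean_space set" and \<psi> :: "'b \<Rightarrow> 'a::euclidean_space" +
  fixes V :: "'b \<Rightarrow> 'b"
  assumes smooth_V: "smooth_on U V"
    and unit: "x \<in> U \<Longrightarrow> g x (V x) (V x) = 1"
    and killing: "x \<in> U \<Longrightarrow>
      metric_deriv g x (V x) X Y + g x (dd X V x) Y + g x X (dd Y V x) = 0"
begin

text \<open>
  The field as a map into the ambient space. It turns covariant derivatives into directional ones:
  \<open>d\<psi>(\<nabla>\<^sub>X V) = D\<^sub>X F + g(X, V) \<psi>\<close>.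
\<close>

definition F :: "'b \<Rightarrow> 'a" where "F x = dd (V x) \<psi> x"

lemma diff_V: "x \<in> U \<Longrightarrow> V differentiable (at x)" "x \<in> U \<Longrightarrow> dd X V differentiable (at x)"
  using smooth_V smooth_on_dd smooth_on_differentiable by blast+

lemma dd_F:
  assumes x: "x \<in> U"
  shows "F differentiable (at x)"
    and "dd X F x = dd X (dd (V x) \<psi>) x + dd (dd X V x) \<psi> x"
proof -
  have "(F has_derivative (\<lambda>X. dd X (dd (V x) \<psi>) x + dd (dd X V x) \<psi> x)) (at x)"
    unfolding F_def
    by (rule has_derivative_family[OF open_U, where L = "\<lambda>x v. dd v \<psi> x" and y = "\<lambda>x. x"])
      (auto intro!: x linear_param diff_param diff_V has_derivative_dd)
  then show "F differentiable (at x)"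
    and "dd X F x = dd X (dd (V x) \<psi>) x + dd (dd X V x) \<psi> x"
    by (auto simp: dd_eqI differentiableI)
qed

text \<open>
  The explicit form is needed because \<open>dd X (dd Y V)\<close>, the derivative of the section in the chart, has
  to be matched with ambient second derivatives when the tension field is computed.
\<close>

lemma dd_dd_F:
  assumes x: "x \<in> U"
  shows "dd Y F differentiable (at x)"
    and "dd X (dd Y F) x = dd X (dd Y (dd (V x) \<psi>)) x + dd Y (dd (dd X V x) \<psi>) x
      + (dd X (dd (dd Y V x) \<psi>) x + dd (dd X (dd Y V) x) \<psi> x)"
proof -
  have 1: "((\<lambda>y. dd Y (dd (V y) \<psi>) y) has_derivative
      (\<lambda>X. dd X (\<lambda>y. dd Y (dd (V x) \<psi>) y) x + dd Y (dd (dd X V x) \<psi>) x)) (at x)"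
    by (rule has_derivative_family[OF open_U, where L = "\<lambda>x v. dd Y (dd v \<psi>) x" and y = "\<lambda>x. x"])
      (auto intro!: x linear_param diff_param diff_V has_derivative_dd)
  have 2: "((\<lambda>y. dd (dd Y V y) \<psi> y) has_derivative
      (\<lambda>X. dd X (\<lambda>y. dd (dd Y V x) \<psi> y) x + dd (dd X (dd Y V) x) \<psi> x)) (at x)"
    by (rule has_derivative_family[OF open_U, where L = "\<lambda>x v. dd v \<psi> x" and y = "\<lambda>x. x"])
      (auto intro!: x linear_param diff_param diff_V has_derivative_dd)
  have "(dd Y F has_derivative (\<lambda>X. dd X (dd Y (dd (V x) \<psi>)) x + dd Y (dd (dd X V x) \<psi>) x
      + (dd X (dd (dd Y V x) \<psi>) x + dd (dd X (dd Y V) x) \<psi> x))) (at x)"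
    by (rule has_derivative_transform_within_open[OF has_derivative_add[OF 1 2] open_U x])
      (simp add: dd_F)
  then show "dd Y F differentiable (at x)"
    and "dd X (dd Y F) x = dd X (dd Y (dd (V x) \<psi>)) x + dd Y (dd (dd X V x) \<psi>) x
      + (dd X (dd (dd Y V x) \<psi>) x + dd (dd X (dd Y V) x) \<psi> x)"
    by (auto simp: dd_eqI differentiableI)
qed

lemma dd_commute_V: "x \<in> U \<Longrightarrow> dd X (dd Y V) x = dd Y (dd X V) x"
  using dd_commute[OF open_U _ smooth_V] .

lemma dd_commute_F:
  assumes x: "x \<in> U"
  shows "dd X (dd Y F) x = dd Y (dd X F) x"
  unfolding dd_dd_F(2)[OF x] dd_commute_V[OF x, of X Y] dd_commute_param(2)[OF x, of X Y]
  by (simp add: algebra_simps)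

text \<open>
  The Killing equation: \<open>g(\<nabla>\<^sub>X V, Y) = \<langle>D\<^sub>X F, d\<psi>(Y)\<rangle>\<close> is skew-symmetric in \<open>X\<close> and \<open>Y\<close>.
\<close>

lemma dd_F_skew:
  assumes x: "x \<in> U"
  shows "dd X F x \<bullet> dd Y \<psi> x + dd Y F x \<bullet> dd X \<psi> x = 0"
proof -
  have "dd Z (dd (V x) \<psi>) x = dd (V x) (dd Z \<psi>) x" for Z by (rule dd_commute_param(1)[OF x])
  then show ?thesis
    using killing[OF x, of X Y] unfolding metric_deriv_g[OF x] g_eq dd_F(2)[OF x]
    by (simp add: inner_add_left inner_add_right inner_commute)
qed

lemma F_normal: "x \<in> U \<Longrightarrow> F x \<bullet> \<psi> x = 0"
  using normal_tangent[of x "V x"] by (simp add: F_def inner_commute)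

lemma dd_F_normal:
  assumes x: "x \<in> U"
  shows "dd X F x \<bullet> \<psi> x = - (F x \<bullet> dd X \<psi> x)"
proof -
  have "dd X (\<lambda>y. F y \<bullet> \<psi> y) x = dd X (\<lambda>y. 0) x"
    using x dd_F diff_param[OF x] by (intro dd_cong_open[OF open_U x]) (auto simp: F_normal)
  then show ?thesis
    using dd_inner[OF dd_F(1)[OF x] diff_param(1)[OF x], of X] by (simp add: dd_def)
qed

lemma F_unit: "x \<in> U \<Longrightarrow> F x \<bullet> F x = 1"
  using unit by (simp add: F_def g_eq)

lemma F_dd_F:
  assumes x: "x \<in> U"
  shows "F x \<bullet> dd X F x = 0"
proof -
  have "dd X (\<lambda>y. F y \<bullet> F y) x = dd X (\<lambda>y. 1) x"
    using x dd_F by (intro dd_cong_open[OF open_U x]) (auto simp: F_unit)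
  then show ?thesis
    using dd_inner[OF dd_F(1)[OF x] dd_F(1)[OF x], of X] by (simp add: dd_def inner_commute)
qed

lemma F_dd_dd_F:
  assumes x: "x \<in> U"
  shows "dd Y (dd X F) x \<bullet> F x = - (dd X F x \<bullet> dd Y F x)"
proof -
  have "dd Y (\<lambda>y. F y \<bullet> dd X F y) x = dd Y (\<lambda>y. 0) x"
    using x dd_F(1) dd_dd_F(1) by (intro dd_cong_open[OF open_U x]) (auto simp: F_dd_F)
  then show ?thesis
    using dd_inner[OF dd_F(1)[OF x] dd_dd_F(1)[OF x], of Y X] by (simp add: dd_def inner_commute)
qed

text \<open>
  The identity \<open>\<nabla>\<^sup>2V = - R(V, \<cdot>)\<close> of Killing fields for the curvature of the unit sphere, in ambient
  form. Differentiating the Killing equation expresses the part symmetric in \<open>Y\<close>, \<open>Z\<close> of a trilinear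
  form \<open>a\<close> that is symmetric in \<open>X\<close>, \<open>Y\<close>; as for Christoffel symbols, this determines \<open>a\<close>.
\<close>

lemma hessian_tangential:
  assumes x: "x \<in> U"
  shows "dd X (dd Y F) x \<bullet> dd Z \<psi> x
    = dd (\<Gamma> x X Y) F x \<bullet> dd Z \<psi> x - (dd X \<psi> x \<bullet> dd Y \<psi> x) * (F x \<bullet> dd Z \<psi> x)"
proof -
  define a where "a X Y Z = dd X (dd Y F) x \<bullet> dd Z \<psi> x - dd (\<Gamma> x X Y) F x \<bullet> dd Z \<psi> x" for X Y Z
  have a_sym: "a X Y Z = a Y X Z" for X Y Z
    by (simp add: a_def dd_commute_F[OF x, of X Y] \<Gamma>_commute[OF x, of X Y])
  have a_skew: "a X Y Z + a X Z Y = - (dd X \<psi> x \<bullet> dd Z \<psi> x) * (F x \<bullet> dd Y \<psi> x)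
      - (dd X \<psi> x \<bullet> dd Y \<psi> x) * (F x \<bullet> dd Z \<psi> x)" for X Y Z
  proof -
    have d1: "dd X (\<lambda>y. dd Y F y \<bullet> dd Z \<psi> y) x
        = dd Y F x \<bullet> dd X (dd Z \<psi>) x + dd X (dd Y F) x \<bullet> dd Z \<psi> x" for Y Z
      by (rule dd_inner[OF dd_dd_F(1)[OF x] diff_param(2)[OF x]])
    have "dd X (\<lambda>y. dd Y F y \<bullet> dd Z \<psi> y + dd Z F y \<bullet> dd Y \<psi> y) x = dd X (\<lambda>y. 0) x"
      using x dd_dd_F(1)[OF x] diff_param[OF x]
      by (intro dd_cong_open[OF open_U x]) (auto simp: dd_F_skew)
    then have 1: "dd X (\<lambda>y. dd Y F y \<bullet> dd Z \<psi> y) x + dd X (\<lambda>y. dd Z F y \<bullet> dd Y \<psi> y) x = 0"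
      using x dd_dd_F(1)[OF x] diff_param[OF x] by (subst (asm) dd_add) (auto simp: dd_def)
    have 2: "dd Y F x \<bullet> dd X (dd Z \<psi>) x
        = - (dd (\<Gamma> x X Z) F x \<bullet> dd Y \<psi> x) + (dd X \<psi> x \<bullet> dd Z \<psi> x) * (F x \<bullet> dd Y \<psi> x)" for Y Z
    proof -
      have "dd X (dd Z \<psi>) x = dd (\<Gamma> x X Z) \<psi> x - (dd X \<psi> x \<bullet> dd Z \<psi> x) *\<^sub>R \<psi> x"
        by (simp add: gauss_formula[OF x])
      then show ?thesis
        using dd_F_skew[OF x, of Y "\<Gamma> x X Z"] by (simp add: inner_diff_right dd_F_normal[OF x])
    qed
    show ?thesis using 1 unfolding d1 2 a_def by (simp add: algebra_simps)
  qed
  have "a X Y Z = - (dd X \<psi> x \<bullet> dd Y \<psi> x) * (F x \<bullet> dd Z \<psi> x)"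
    using a_skew[of X Y Z] a_skew[of Y Z X] a_skew[of Z X Y] a_sym[of X Z Y] a_sym[of Y X Z] a_sym[of Z Y X]
    by (simp add: inner_commute)
  then show ?thesis by (simp add: a_def)
qed

text \<open>
  Differentiating \<open>|F|\<^sup>2 = 1\<close> twice relates \<open>\<langle>D\<^sub>X F, D\<^sub>Y F\<rangle>\<close> to the component along \<open>F\<close> of the Hessian.
  As \<open>F\<close> is tangent, that component is known.
\<close>

lemma dd_F_inner_dd_F:
  assumes x: "x \<in> U"
  shows "dd X F x \<bullet> dd Y F x = dd X \<psi> x \<bullet> dd Y \<psi> x"
proof -
  have "dd (\<Gamma> x Y X) F x \<bullet> F x = 0" using F_dd_F[OF x] by (simp add: inner_commute)
  then show ?thesis
    using hessian_tangential[OF x, of Y X "V x"] F_dd_dd_F[OF x, of Y X] F_unit[OF x]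
    by (simp add: F_def[symmetric] inner_commute)
qed

end

section \<open>The form of a natural metric in the ambient space\<close>

text \<open>
  The value of a natural metric at \<open>(x, u)\<close> in terms of ambient vectors: \<open>v\<close> stands for \<open>d\<psi>(u)\<close>, and for
  \<open>w = X\<^sup>h + Y\<^sup>v\<close> the vector \<open>a\<close> (or \<open>b\<close>) is \<open>d\<psi>(X)\<close> and \<open>r\<close> (or \<open>s\<close>) is the derivative of \<open>d\<psi>(u)\<close> in the
  direction \<open>w\<close>. The vector \<open>d\<psi>(Y)\<close> is the tangential part of \<open>r\<close>; the normal part has length
  \<open>\<bar>a \<bullet> v\<bar>\<close>, which explains the correction subtracted from \<open>r \<bullet> s\<close>. In this form no Christoffel symbols
  occur, so that differentiating in \<open>(x, u)\<close> only needs derivatives of \<open>\<psi>\<close>.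
\<close>

definition natural_form ::
  "(nat \<Rightarrow> real \<Rightarrow> real) \<Rightarrow> (nat \<Rightarrow> real \<Rightarrow> real) \<Rightarrow> 'a::euclidean_space \<Rightarrow> 'a \<Rightarrow> 'a \<Rightarrow> 'a \<Rightarrow> 'a \<Rightarrow> real" where
  "natural_form \<alpha> \<beta> v a r b s =
     (\<alpha> 1 (v \<bullet> v) + \<alpha> 3 (v \<bullet> v)) * (a \<bullet> b) + (\<beta> 1 (v \<bullet> v) + \<beta> 3 (v \<bullet> v)) * ((a \<bullet> v) * (b \<bullet> v))
     + \<alpha> 2 (v \<bullet> v) * (a \<bullet> s + r \<bullet> b)
     + \<beta> 2 (v \<bullet> v) * ((a \<bullet> v) * (s \<bullet> v) + (r \<bullet> v) * (b \<bullet> v))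
     + \<alpha> 1 (v \<bullet> v) * (r \<bullet> s - (a \<bullet> v) * (b \<bullet> v)) + \<beta> 1 (v \<bullet> v) * ((r \<bullet> v) * (s \<bullet> v))"

lemma natural_form_has_derivative:
  assumes \<alpha>: "\<And>i. i \<in> {1, 2, 3} \<Longrightarrow> (\<alpha> i has_real_derivative \<alpha>' i) (at 1)"
    and \<beta>: "\<And>i. i \<in> {1, 2, 3} \<Longrightarrow> (\<beta> i has_real_derivative \<beta>' i) (at 1)"
    and unit: "v z \<bullet> v z = 1"
    and [derivative_intros]: "(v has_derivative dv) (at z)" "(a has_derivative da) (at z)"
      "(b has_derivative db) (at z)" "(r has_derivative dr) (at z)" "(s has_derivative ds) (at z)"
  shows "((\<lambda>z. natural_form \<alpha> \<beta> (v z) (a z) (r z) (b z) (s z)) has_derivative (\<lambda>h.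
      (2 * (v z \<bullet> dv h)) *
       ((\<alpha>' 1 + \<alpha>' 3) * (a z \<bullet> b z) + (\<beta>' 1 + \<beta>' 3) * ((a z \<bullet> v z) * (b z \<bullet> v z))
       + \<alpha>' 2 * (a z \<bullet> s z + r z \<bullet> b z)
       + \<beta>' 2 * ((a z \<bullet> v z) * (s z \<bullet> v z) + (r z \<bullet> v z) * (b z \<bullet> v z))
       + \<alpha>' 1 * (r z \<bullet> s z - (a z \<bullet> v z) * (b z \<bullet> v z)) + \<beta>' 1 * ((r z \<bullet> v z) * (s z \<bullet> v z)))
      + (\<alpha> 1 1 + \<alpha> 3 1) * (a z \<bullet> db h + da h \<bullet> b z)
      + (\<beta> 1 1 + \<beta> 3 1) * ((a z \<bullet> dv h + da h \<bullet> v z) * (b z \<bullet> v z) + (a z \<bullet> v z) * (b z \<bullet> dv h + db h \<bullet> v z))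
      + \<alpha> 2 1 * (a z \<bullet> ds h + da h \<bullet> s z + r z \<bullet> db h + dr h \<bullet> b z)
      + \<beta> 2 1 * ((a z \<bullet> dv h + da h \<bullet> v z) * (s z \<bullet> v z) + (a z \<bullet> v z) * (s z \<bullet> dv h + ds h \<bullet> v z)
                + (r z \<bullet> dv h + dr h \<bullet> v z) * (b z \<bullet> v z) + (r z \<bullet> v z) * (b z \<bullet> dv h + db h \<bullet> v z))
      + \<alpha> 1 1 * (r z \<bullet> ds h + dr h \<bullet> s z
                - (a z \<bullet> dv h + da h \<bullet> v z) * (b z \<bullet> v z) - (a z \<bullet> v z) * (b z \<bullet> dv h + db h \<bullet> v z))
      + \<beta> 1 1 * ((r z \<bullet> dv h + dr h \<bullet> v z) * (s z \<bullet> v z) + (r z \<bullet> v z) * (s z \<bullet> dv h + ds h \<bullet> v z))))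
     (at z)"
proof -
  have vv: "((\<lambda>z. f (v z \<bullet> v z)) has_derivative (\<lambda>h. D * (2 * (v z \<bullet> dv h)))) (at z)"
    if "(f has_real_derivative D) (at 1)" for f :: "real \<Rightarrow> real" and D
  proof -
    have "((\<lambda>z. v z \<bullet> v z) has_derivative (\<lambda>h. 2 * (v z \<bullet> dv h))) (at z)"
      by (auto intro!: derivative_eq_intros simp: inner_commute)
    moreover have "(f has_derivative (\<lambda>k. D * k)) (at (v z \<bullet> v z))"
      using that by (simp add: has_field_derivative_def unit)
    ultimately show ?thesis by (rule has_derivative_compose)
  qed
  have [derivative_intros]: "((\<lambda>z. \<alpha> 1 (v z \<bullet> v z)) has_derivative (\<lambda>h. \<alpha>' 1 * (2 * (v z \<bullet> dv h)))) (at z)"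
    "((\<lambda>z. \<alpha> 2 (v z \<bullet> v z)) has_derivative (\<lambda>h. \<alpha>' 2 * (2 * (v z \<bullet> dv h)))) (at z)"
    "((\<lambda>z. \<alpha> 3 (v z \<bullet> v z)) has_derivative (\<lambda>h. \<alpha>' 3 * (2 * (v z \<bullet> dv h)))) (at z)"
    "((\<lambda>z. \<beta> 1 (v z \<bullet> v z)) has_derivative (\<lambda>h. \<beta>' 1 * (2 * (v z \<bullet> dv h)))) (at z)"
    "((\<lambda>z. \<beta> 2 (v z \<bullet> v z)) has_derivative (\<lambda>h. \<beta>' 2 * (2 * (v z \<bullet> dv h)))) (at z)"
    "((\<lambda>z. \<beta> 3 (v z \<bullet> v z)) has_derivative (\<lambda>h. \<beta>' 3 * (2 * (v z \<bullet> dv h)))) (at z)"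
    using \<alpha> \<beta> by (auto intro!: vv)
  show ?thesis
    unfolding natural_form_def
    by (rule has_derivative_eq_rhs)
      ((rule has_derivative_inner has_derivative_mult has_derivative_add has_derivative_diff
          derivative_intros)+, rule ext, simp add: unit algebra_simps)
qed

section \<open>The tension field of a Hopf field\<close>

lemma (in sphere_chart) natural_metric_eq_natural_form:
  assumes y: "y \<in> U"
  shows "natural_metric \<alpha> \<beta> g (y, u) w w' = natural_form \<alpha> \<beta> (dd u \<psi> y)
    (dd (fst w) \<psi> y) (dd (snd w) \<psi> y + dd (fst w) (dd u \<psi>) y)
    (dd (fst w') \<psi> y) (dd (snd w') \<psi> y + dd (fst w') (dd u \<psi>) y)"
proof -
  define R where "R w = dd (snd w) \<psi> y + dd (fst w) (dd u \<psi>) y" for w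
  have ver: "dd (ver_part g (y, u) w) \<psi> y = R w + (dd (fst w) \<psi> y \<bullet> dd u \<psi> y) *\<^sub>R \<psi> y" for w
    by (simp add: ver_part_def R_def linear_add[OF linear_param(1)[OF y]] gauss_formula[OF y])
  have RR: "R w \<bullet> \<psi> y = - (dd (fst w) \<psi> y \<bullet> dd u \<psi> y)" for w
    using normal_second_derivative[OF y] normal_tangent[OF y]
    by (simp add: R_def inner_add_right inner_commute[of _ "\<psi> y"] inner_commute[of "dd u \<psi> y"])
  have VV: "g y (ver_part g (y, u) w) (ver_part g (y, u) w')
      = R w \<bullet> R w' - (dd (fst w) \<psi> y \<bullet> dd u \<psi> y) * (dd (fst w') \<psi> y \<bullet> dd u \<psi> y)"
    using RR[of w] RR[of w']
    by (simp add: g_eq[of y] ver inner_add_left inner_add_right on_sphere[OF y] inner_commute[of "\<psi> y" "R w'"])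
  have VP: "g y (ver_part g (y, u) w) z = R w \<bullet> dd z \<psi> y"
    "g y z (ver_part g (y, u) w) = dd z \<psi> y \<bullet> R w" for w z
    using normal_tangent[OF y, of z]
    by (simp_all add: g_eq[of y] ver inner_add_left inner_add_right inner_commute[of _ "\<psi> y"])
  show ?thesis
    unfolding natural_metric_def Let_def natural_form_def hor_part_def R_def[symmetric] fst_conv snd_conv
    unfolding VV
    unfolding VP
    unfolding g_eq[of y]
    by (simp add: algebra_simps)
qed

text \<open>
  Only the values and first derivatives of the coefficients at \<open>1 = |V|\<^sup>2\<close> enter the computation;
  \<open>\<alpha>' i\<close> and \<open>\<beta>' i\<close> are these derivatives.
\<close>

locale natural_hopf_chart = hopf_chart U \<psi> V
  for U :: "'b::euclidean_space set" and \<psi> :: "'b \<Rightarrow> 'a::euclidean_space" and V +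
  fixes \<alpha> \<beta> :: "nat \<Rightarrow> real \<Rightarrow> real" and \<alpha>' \<beta>' :: "nat \<Rightarrow> real"
  assumes deriv_\<alpha>: "\<And>i. i \<in> {1, 2, 3} \<Longrightarrow> (\<alpha> i has_real_derivative \<alpha>' i) (at 1)"
    and deriv_\<beta>: "\<And>i. i \<in> {1, 2, 3} \<Longrightarrow> (\<beta> i has_real_derivative \<beta>' i) (at 1)"
    and pos_G: "x \<in> U \<Longrightarrow> w \<noteq> 0 \<Longrightarrow> natural_metric \<alpha> \<beta> g (x, u) w w > 0"
begin

abbreviation G :: "('b \<times> 'b) metric" where "G \<equiv> natural_metric \<alpha> \<beta> g"

lemma G_metric:
  assumes p: "p \<in> U \<times> UNIV"
  shows "bilinear (G p)" "G p w w' = G p w' w" "w \<noteq> 0 \<Longrightarrow> G p w w > 0"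
proof -
  obtain x u where p': "p = (x, u)" and x: "x \<in> U" using p by auto
  note [simp] = linear_add[OF linear_param(1)[OF x]] linear_scale[OF linear_param(1)[OF x]]
    linear_add[OF linear_param(3)[OF x]] linear_scale[OF linear_param(3)[OF x]]
  show "bilinear (G p)"
    unfolding bilinear_def p' natural_metric_eq_natural_form[OF x] natural_form_def
    by (intro conjI allI linearI) (simp_all add: algebra_simps inner_simps)
  show "G p w w' = G p w' w"
    unfolding p' natural_metric_eq_natural_form[OF x] natural_form_def
    by (simp add: inner_commute algebra_simps)
  show "w \<noteq> 0 \<Longrightarrow> G p w w > 0" using pos_G[OF x] p' by simp
qed

lemma open_tangent: "open (U \<times> (UNIV :: 'b set))"
  by (simp add: open_U open_Times)

text \<open>
  The derivative of \<open>natural_form\<close> along the chart of the tangent bundle: \<open>dv\<close>, \<open>da\<close> and \<open>dr\<close> are the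
  derivatives of \<open>v\<close>, \<open>a\<close> and \<open>r\<close> in the direction \<open>h\<close>, at points of the section \<open>V\<close>.
\<close>

lemma metric_deriv_G:
  assumes x: "x \<in> U"
  defines "v \<equiv> F x" and "a \<equiv> \<lambda>w. dd (fst w) \<psi> x"
    and "r \<equiv> \<lambda>w. dd (snd w) \<psi> x + dd (fst w) (dd (V x) \<psi>) x"
    and "dv \<equiv> \<lambda>h. dd (fst h) (dd (V x) \<psi>) x + dd (snd h) \<psi> x"
    and "da \<equiv> \<lambda>w h. dd (fst h) (dd (fst w) \<psi>) x"
    and "dr \<equiv> \<lambda>w h. dd (fst h) (dd (snd w) \<psi>) x
           + (dd (fst h) (dd (fst w) (dd (V x) \<psi>)) x + dd (fst w) (dd (snd h) \<psi>) x)"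
  shows "(\<lambda>p. G p w w') differentiable (at (x, V x))" (is ?d)
    and "metric_deriv G (x, V x) h w w' = 
      (2 * (v \<bullet> dv h)) *
       ((\<alpha>' 1 + \<alpha>' 3) * (a w \<bullet> a w') + (\<beta>' 1 + \<beta>' 3) * ((a w \<bullet> v) * (a w' \<bullet> v))
       + \<alpha>' 2 * (a w \<bullet> r w' + r w \<bullet> a w')
       + \<beta>' 2 * ((a w \<bullet> v) * (r w' \<bullet> v) + (r w \<bullet> v) * (a w' \<bullet> v))
       + \<alpha>' 1 * (r w \<bullet> r w' - (a w \<bullet> v) * (a w' \<bullet> v)) + \<beta>' 1 * ((r w \<bullet> v) * (r w' \<bullet> v)))
      + (\<alpha> 1 1 + \<alpha> 3 1) * (a w \<bullet> da w' h + da w h \<bullet> a w')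
      + (\<beta> 1 1 + \<beta> 3 1) * ((a w \<bullet> dv h + da w h \<bullet> v) * (a w' \<bullet> v) + (a w \<bullet> v) * (a w' \<bullet> dv h + da w' h \<bullet> v))
      + \<alpha> 2 1 * (a w \<bullet> dr w' h + da w h \<bullet> r w' + r w \<bullet> da w' h + dr w h \<bullet> a w')
      + \<beta> 2 1 * ((a w \<bullet> dv h + da w h \<bullet> v) * (r w' \<bullet> v) + (a w \<bullet> v) * (r w' \<bullet> dv h + dr w' h \<bullet> v)
                + (r w \<bullet> dv h + dr w h \<bullet> v) * (a w' \<bullet> v) + (r w \<bullet> v) * (a w' \<bullet> dv h + da w' h \<bullet> v))
      + \<alpha> 1 1 * (r w \<bullet> dr w' h + dr w h \<bullet> r w'
                - (a w \<bullet> dv h + da w h \<bullet> v) * (a w' \<bullet> v) - (a w \<bullet> v) * (a w' \<bullet> dv h + da w' h \<bullet> v))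
      + \<beta> 1 1 * ((r w \<bullet> dv h + dr w h \<bullet> v) * (r w' \<bullet> v) + (r w \<bullet> v) * (r w' \<bullet> dv h + dr w' h \<bullet> v))"
      (is "_ = ?D h")
proof -
  let ?p = "(x, V x)"
  have fst_snd: "(fst has_derivative fst) (at ?p)" "(snd has_derivative snd) (at ?p)"
    by (auto intro: bounded_linear_imp_has_derivative bounded_linear_fst bounded_linear_snd)
  have base: "((\<lambda>p. f (fst p)) has_derivative (\<lambda>h. dd (fst h) f x)) (at ?p)"
    if "f differentiable (at x)" for f :: "'b \<Rightarrow> 'a"
    using has_derivative_compose[OF fst_snd(1), of f] has_derivative_dd[OF that] by simp
  have d_v: "((\<lambda>p. dd (snd p) \<psi> (fst p)) has_derivative dv) (at ?p)"
    using has_derivative_family[OF open_U _ _ _ fst_snd, where L = "\<lambda>x v. dd v \<psi> x"]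
    by (simp add: x linear_param diff_param dv_def)
  have d_H: "((\<lambda>p. dd X (dd (snd p) \<psi>) (fst p)) has_derivative
      (\<lambda>h. dd (fst h) (dd X (dd (V x) \<psi>)) x + dd X (dd (snd h) \<psi>) x)) (at ?p)" for X
    using has_derivative_family[OF open_U _ _ _ fst_snd, where L = "\<lambda>x v. dd X (dd v \<psi>) x"]
    by (simp add: x linear_param diff_param)
  have d_a: "((\<lambda>p. dd (fst w) \<psi> (fst p)) has_derivative da w) (at ?p)" for w :: "'b \<times> 'b"
    unfolding da_def by (rule base) (rule diff_param[OF x])
  have d_r: "((\<lambda>p. dd (snd w) \<psi> (fst p) + dd (fst w) (dd (snd p) \<psi>) (fst p)) has_derivative dr w) (at ?p)"
    for w :: "'b \<times> 'b"
    unfolding dr_def by (intro has_derivative_add base diff_param x d_H)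
  have unit': "dd (snd ?p) \<psi> (fst ?p) \<bullet> dd (snd ?p) \<psi> (fst ?p) = 1"
    using F_unit[OF x] by (simp add: F_def)
  have "((\<lambda>p. natural_form \<alpha> \<beta> (dd (snd p) \<psi> (fst p))
      (dd (fst w) \<psi> (fst p)) (dd (snd w) \<psi> (fst p) + dd (fst w) (dd (snd p) \<psi>) (fst p))
      (dd (fst w') \<psi> (fst p)) (dd (snd w') \<psi> (fst p) + dd (fst w') (dd (snd p) \<psi>) (fst p)))
     has_derivative ?D) (at ?p)"
    using natural_form_has_derivative[where \<alpha> = \<alpha> and \<beta> = \<beta>, OF deriv_\<alpha> deriv_\<beta> unit' d_v d_a[of w] d_a[of w'] d_r[of w] d_r[of w']]
    unfolding v_def F_def a_def r_def by simp
  from has_derivative_transform_within_open[OF this open_tangent, of "\<lambda>p. G p w w'"]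
  have "((\<lambda>p. G p w w') has_derivative ?D) (at ?p)"
    by (auto simp: x natural_metric_eq_natural_form)
  then show ?d and "metric_deriv G (x, V x) h w w' = ?D h"
    by (auto simp: metric_deriv_eq_dd dd_eqI differentiableI)
qed

lemma levi_civita_G:
  assumes x: "x \<in> U"
  shows "bilinear (levi_civita G (x, V x))"
    and "levi_civita G (x, V x) A B = levi_civita G (x, V x) B A"
    and "G (x, V x) (levi_civita G (x, V x) A B) C = (metric_deriv G (x, V x) A B C
      + metric_deriv G (x, V x) B A C - metric_deriv G (x, V x) C A B) / 2"
proof -
  have p: "(x, V x) \<in> U \<times> UNIV" using x by simp
  note lc = levi_civita_koszul[OF open_tangent p G_metric(1) G_metric(2) G_metric(3)[OF p] metric_deriv_G(1)[OF x]]
  show "bilinear (levi_civita G (x, V x))" by (rule lc)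
  show "levi_civita G (x, V x) A B = levi_civita G (x, V x) B A" by (rule lc)
  show "G (x, V x) (levi_civita G (x, V x) A B) C = (metric_deriv G (x, V x) A B C
      + metric_deriv G (x, V x) B A C - metric_deriv G (x, V x) C A B) / 2" by (rule lc)
qed

lemma second_fundamental_form_section:
  assumes x: "x \<in> U"
  shows "second_fundamental_form g G (\<lambda>y. (y, V y)) x X Y =
    (0, dd X (dd Y V) x) + levi_civita G (x, V x) (X, dd X V x) (Y, dd Y V x)
    - (\<Gamma> x X Y, dd (\<Gamma> x X Y) V x)"
proof -
  have 1: "dd Y (\<lambda>y. (y, V y)) y = (Y, dd Y V y)" if "y \<in> U" for y Y
    by (rule dd_eqI[where f' = "\<lambda>Y. (Y, dd Y V y)"])
      (auto intro!: has_derivative_Pair has_derivative_dd diff_V that)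
  have "((\<lambda>y. (Y, dd Y V y)) has_derivative (\<lambda>X. (0, dd X (dd Y V) x))) (at x)"
    by (auto intro!: has_derivative_Pair has_derivative_dd diff_V x)
  from has_derivative_transform_within_open[OF this open_U x, of "dd Y (\<lambda>y. (y, V y))"]
  have "dd X (dd Y (\<lambda>y. (y, V y))) x = (0, dd X (dd Y V) x)"
    using 1 by (intro dd_eqI) auto
  then show ?thesis
    unfolding second_fundamental_form_def frechet_derivative_eq_dd by (simp add: 1 x)
qed

text \<open>
  The term \<open>A G(A, W)\<close> of the Koszul formula, with \<open>A = dV(X)\<close> and \<open>W = Y\<^sup>v\<close>. Along the section the
  coefficients are constant as \<open>|V| = 1\<close>, so none of their derivatives occur.
\<close>

lemma metric_deriv_G_along_field:
  fixes X Y :: 'b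
  assumes x: "x \<in> U"
  defines "A \<equiv> (X, dd X V x)" and "W \<equiv> (0, Y)"
  shows "metric_deriv G (x, V x) A A W =
    \<alpha> 2 1 * (dd X \<psi> x \<bullet> dd X (dd Y \<psi>) x + dd X (dd X \<psi>) x \<bullet> dd Y \<psi> x)
    + \<beta> 2 1 * ((dd X \<psi> x \<bullet> dd X F x + dd X (dd X \<psi>) x \<bullet> F x) * (dd Y \<psi> x \<bullet> F x)
        + (dd X \<psi> x \<bullet> F x) * (dd Y \<psi> x \<bullet> dd X F x + dd X (dd Y \<psi>) x \<bullet> F x))
    + \<alpha> 1 1 * (dd X F x \<bullet> dd X (dd Y \<psi>) x
        + (dd X (dd X F) x - dd (dd X (dd X V) x) \<psi> x) \<bullet> dd Y \<psi> x)
    + \<beta> 1 1 * (dd X F x \<bullet> dd X F x + (dd X (dd X F) x - dd (dd X (dd X V) x) \<psi> x) \<bullet> F x)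
        * (dd Y \<psi> x \<bullet> F x)"
proof -
  have 0: "dd 0 \<psi> x = 0" "dd X (dd 0 \<psi>) x = 0" "dd 0 f x = 0" 
      if "f differentiable (at x)" for X and f :: "'b \<Rightarrow> 'a"
    using linear_0[OF linear_param(1)[OF x]] linear_0[OF linear_param(2)[OF x]] linear_0[OF linear_dd[OF that]]
    by simp_all
  have 1: "dd 0 (dd u \<psi>) x = 0" "dd 0 (dd u (dd v \<psi>)) x = 0" "dd X (dd 0 (dd v \<psi>)) x = 0" for u v X
    using 0(3)[OF diff_param(2)[OF x]] 0(3)[OF diff_param(3)[OF x]] dd_commute_param(2)[OF x, of X 0 v]
    by simp_all
  have 2: "F x \<bullet> dd X F x = 0" "dd X F x \<bullet> F x = 0"
    using F_dd_F[OF x] by (simp_all add: inner_commute)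
  have 3: "dd X (dd (V x) \<psi>) x + dd (dd X V x) \<psi> x = dd X F x"
    "dd (dd X V x) \<psi> x + dd X (dd (V x) \<psi>) x = dd X F x"
    by (simp_all add: dd_F(2)[OF x])
  have 4: "dd X (dd (dd X V x) \<psi>) x + (dd X (dd X (dd (V x) \<psi>)) x + dd X (dd (dd X V x) \<psi>) x)
     = dd X (dd X F) x - dd (dd X (dd X V) x) \<psi> x"
    by (simp add: dd_dd_F(2)[OF x])
  show ?thesis
    unfolding metric_deriv_G(2)[OF x] A_def W_def fst_conv snd_conv 0[OF diff_param(2)[OF x]] 1 3 4
    by (simp add: 2 algebra_simps)
qed

text \<open>
  The term \<open>W G(A, A)\<close> of the Koszul formula. In the fibre direction \<open>Y\<close> the square length of the base
  point changes at the rate \<open>2 g(V, Y)\<close>, which is how derivatives of the coefficients enter.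
\<close>

lemma metric_deriv_G_along_fibre:
  fixes X Y :: 'b
  assumes x: "x \<in> U"
  defines "A \<equiv> (X, dd X V x)" and "W \<equiv> (0, Y)"
  shows "metric_deriv G (x, V x) W A A =
    2 * (F x \<bullet> dd Y \<psi> x) * ((\<alpha>' 1 + \<alpha>' 3) * (dd X \<psi> x \<bullet> dd X \<psi> x)
       + (\<beta>' 1 + \<beta>' 3) * (dd X \<psi> x \<bullet> F x)^2 + 2 * \<alpha>' 2 * (dd X \<psi> x \<bullet> dd X F x)
       + \<alpha>' 1 * (dd X F x \<bullet> dd X F x - (dd X \<psi> x \<bullet> F x)^2))
    + 2 * (\<beta> 1 1 + \<beta> 3 1) * (dd X \<psi> x \<bullet> dd Y \<psi> x) * (dd X \<psi> x \<bullet> F x)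
    + 2 * \<alpha> 2 1 * (dd X \<psi> x \<bullet> dd X (dd Y \<psi>) x)
    + 2 * \<beta> 2 1 * (dd X \<psi> x \<bullet> F x) * (dd X F x \<bullet> dd Y \<psi> x + dd X (dd Y \<psi>) x \<bullet> F x)
    + 2 * \<alpha> 1 1 * (dd X F x \<bullet> dd X (dd Y \<psi>) x - (dd X \<psi> x \<bullet> F x) * (dd X \<psi> x \<bullet> dd Y \<psi> x))"
proof -
  have 0: "dd 0 f x = 0" if "f differentiable (at x)" for f :: "'b \<Rightarrow> 'a"
    using linear_0[OF linear_dd[OF that]] by simp
  have 1: "dd 0 (dd u \<psi>) x = 0" "dd 0 (dd u (dd v \<psi>)) x = 0" for u v
    using 0[OF diff_param(2)[OF x]] 0[OF diff_param(3)[OF x]] by simp_all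
  have 2: "F x \<bullet> dd X F x = 0" "dd X F x \<bullet> F x = 0"
    using F_dd_F[OF x] by (simp_all add: inner_commute)
  have 3: "dd (dd X V x) \<psi> x + dd X (dd (V x) \<psi>) x = dd X F x"
    by (simp add: dd_F(2)[OF x])
  show ?thesis
    unfolding metric_deriv_G(2)[OF x] A_def W_def fst_conv snd_conv 1 3
    by (simp add: 2 inner_commute[of "dd X F x" "dd X \<psi> x"]
        inner_commute[of "dd X (dd Y \<psi>) x" "dd X F x"]
        inner_commute[of "dd X (dd Y \<psi>) x" "dd X \<psi> x"] power2_eq_square algebra_simps)
qed

text \<open>
  The heart of the computation. The terms with \<open>\<alpha>\<^sub>2\<close> and \<open>\<beta>\<^sub>2\<close> and those with second derivatives of \<open>\<psi>\<close>
  cancel between the Koszul formula and the corrections \<open>D\<^sub>X D\<^sub>X V\<close> and \<open>dV(\<Gamma>(X, X))\<close>; the second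
  derivative of \<open>F\<close> is removed by \<open>hessian_tangential\<close> and \<open>|D\<^sub>X F|\<^sup>2\<close> by \<open>dd_F_inner_dd_F\<close>.
\<close>

lemma second_fundamental_form_vertical_quadratic:
  assumes x: "x \<in> U"
  shows "G (x, V x) (second_fundamental_form g G (\<lambda>y. (y, V y)) x X X) (0, Y) =
    (- \<alpha> 1 1 - \<alpha>' 1 - \<alpha>' 3 - \<alpha>' 1) * g x X X * g x (V x) Y
    + (\<alpha>' 1 - \<beta>' 1 - \<beta>' 3) * (g x X (V x))\<^sup>2 * g x (V x) Y
    + (\<alpha> 1 1 - \<beta> 1 1 - \<beta> 3 1) * g x X (V x) * g x X Y"
proof -
  let ?p = "(x, V x)" let ?A = "(X, dd X V x)" let ?W = "(0, Y)"
  have p: "?p \<in> U \<times> UNIV" using x by simp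
  note bilG = G_metric(1)[OF p]
  have dd0: "dd 0 \<psi> x = 0" "dd 0 (dd u \<psi>) x = 0" for u
    using linear_0[OF linear_param(1)[OF x]] linear_0[OF linear_param(3)[OF x]] by simp_all
  define q where "q = dd Y \<psi> x \<bullet> F x"
  have K: "G ?p (levi_civita G ?p ?A ?A) ?W
      = metric_deriv G ?p ?A ?A ?W - metric_deriv G ?p ?W ?A ?A / 2"
    by (simp add: levi_civita_G(3)[OF x])
  have vert: "G ?p (0, dd X (dd X V) x) ?W =
      \<alpha> 1 1 * (dd (dd X (dd X V) x) \<psi> x \<bullet> dd Y \<psi> x) + \<beta> 1 1 * (dd (dd X (dd X V) x) \<psi> x \<bullet> F x) * q"
    unfolding natural_metric_eq_natural_form[OF x] natural_form_def F_def[symmetric] F_unit[OF x] q_def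
    by (simp add: dd0)
  have r: "dd (dd Z V x) \<psi> x + dd Z (dd (V x) \<psi>) x = dd Z F x" for Z
    by (simp add: dd_F(2)[OF x])
  have base: "G ?p (Z, dd Z V x) ?W = \<alpha> 2 1 * (dd Z \<psi> x \<bullet> dd Y \<psi> x)
      + \<beta> 2 1 * (dd Z \<psi> x \<bullet> F x) * q + \<alpha> 1 1 * (dd Z F x \<bullet> dd Y \<psi> x)" for Z
    unfolding natural_metric_eq_natural_form[OF x] natural_form_def F_def[symmetric] F_unit[OF x] q_def
    using F_dd_F[OF x, of Z] by (simp add: dd0 r inner_commute[of "dd Z F x" "F x"])
  have \<Gamma>: "dd (\<Gamma> x X X) \<psi> x \<bullet> dd Y \<psi> x = dd X (dd X \<psi>) x \<bullet> dd Y \<psi> x"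
    "dd (\<Gamma> x X X) \<psi> x \<bullet> F x = dd X (dd X \<psi>) x \<bullet> F x"
    using normal_tangent[OF x, of Y] F_normal[OF x]
    by (simp_all add: gauss_formula[OF x] inner_add_left inner_commute[of "\<psi> x" "F x"])
  have skew': "dd X \<psi> x \<bullet> dd X F x = 0" using dd_F_skew[OF x, of X X] by (simp add: inner_commute)
  have ff: "dd X F x \<bullet> dd X F x = dd X \<psi> x \<bullet> dd X \<psi> x" by (rule dd_F_inner_dd_F[OF x])
  have f2: "dd X (dd X F) x \<bullet> F x = - (dd X \<psi> x \<bullet> dd X \<psi> x)"
    using F_dd_dd_F[OF x, of X X] ff by simp
  note hess = hessian_tangential[OF x, of X X Y]
  have "G ?p (second_fundamental_form g G (\<lambda>y. (y, V y)) x X X) ?W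
     = G ?p (0, dd X (dd X V) x) ?W + G ?p (levi_civita G ?p ?A ?A) ?W
       - G ?p (\<Gamma> x X X, dd (\<Gamma> x X X) V x) ?W"
    unfolding second_fundamental_form_section[OF x]
    by (simp only: bilinear_ladd[OF bilG] bilinear_lsub[OF bilG])
  also have "\<dots> = (- \<alpha> 1 1 - \<alpha>' 1 - \<alpha>' 3 - \<alpha>' 1) * (dd X \<psi> x \<bullet> dd X \<psi> x) * (F x \<bullet> dd Y \<psi> x)
    + (\<alpha>' 1 - \<beta>' 1 - \<beta>' 3) * (dd X \<psi> x \<bullet> F x)\<^sup>2 * (F x \<bullet> dd Y \<psi> x)
    + (\<alpha> 1 1 - \<beta> 1 1 - \<beta> 3 1) * (dd X \<psi> x \<bullet> F x) * (dd X \<psi> x \<bullet> dd Y \<psi> x)"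
    unfolding K vert base metric_deriv_G_along_field[OF x] metric_deriv_G_along_fibre[OF x]
      inner_diff_left \<Gamma> skew' ff f2 hess q_def inner_commute[of "dd Y \<psi> x" "F x"]
      inner_commute[of "dd Y \<psi> x" "dd X F x"]
    by (simp add: field_simps power2_eq_square)
  finally show ?thesis by (simp only: g_eq[of x] F_def)
qed

lemma second_fundamental_form_bilinear:
  assumes x: "x \<in> U"
  defines "B \<equiv> second_fundamental_form g G (\<lambda>y. (y, V y)) x"
  shows "bilinear B" and "B X Y = B Y X"
proof -
  have p: "(x, V x) \<in> U \<times> UNIV" using x by simp
  have sym: "B X Y = B Y X" for X Y
    unfolding B_def second_fundamental_form_section[OF x]
    by (simp add: dd_commute_V[OF x, of X] levi_civita_G(2)[OF x, of "(X, dd X V x)" "(Y, dd Y V x)"] \<Gamma>_commute[OF x, of X])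
  have "linear (\<lambda>X. B X Y)" for Y
  proof (rule linearI)
    note lin = linear_add[OF linear_dd[OF diff_V(1)[OF x]]] linear_scale[OF linear_dd[OF diff_V(1)[OF x]]]
      linear_add[OF linear_dd[OF diff_V(2)[OF x]]] linear_scale[OF linear_dd[OF diff_V(2)[OF x]]]
      bilinear_ladd[OF bilinear_\<Gamma>[OF x]] bilinear_lmul[OF bilinear_\<Gamma>[OF x]]
    note lc = bilinear_ladd[OF levi_civita_G(1)[OF x]] bilinear_lmul[OF levi_civita_G(1)[OF x]]
    have pair: "(X + X', dd X V x + dd X' V x) = (X, dd X V x) + (X', dd X' V x)"
      "(c *\<^sub>R X, c *\<^sub>R dd X V x) = c *\<^sub>R (X, dd X V x)" for X X' c by simp_all
    show "B (X + X') Y = B X Y + B X' Y" for X X'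
      unfolding B_def second_fundamental_form_section[OF x] lin pair lc by simp
    show "B (c *\<^sub>R X) Y = c *\<^sub>R B X Y" for c X
      unfolding B_def second_fundamental_form_section[OF x] lin pair lc
      by (simp add: scaleR_add_right scaleR_diff_right)
  qed
  moreover have "(\<lambda>X. B X Y) = B Y" for Y by (rule ext) (rule sym)
  ultimately show "bilinear B" unfolding bilinear_def by metis
  show "B X Y = B Y X" by (rule sym)
qed

text \<open>
  Polarization. Symmetry of the second fundamental form lets the previous calculation be done on the
  diagonal only.
\<close>

lemma second_fundamental_form_vertical:
  assumes x: "x \<in> U"
  shows "G (x, V x) (second_fundamental_form g G (\<lambda>y. (y, V y)) x X Z) (0, Y) =
    (- \<alpha> 1 1 - \<alpha>' 1 - \<alpha>' 3 - \<alpha>' 1) * g x (V x) Y * g x X Z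
    + (\<alpha>' 1 - \<beta>' 1 - \<beta>' 3) * g x (V x) Y * (g x X (V x) * g x Z (V x))
    + (\<alpha> 1 1 - \<beta> 1 1 - \<beta> 3 1) / 2 * (g x X (V x) * g x Z Y + g x X Y * g x Z (V x))"
proof -
  define B where "B = second_fundamental_form g G (\<lambda>y. (y, V y)) x"
  have p: "(x, V x) \<in> U \<times> UNIV" using x by simp
  note bilB = second_fundamental_form_bilinear(1)[OF x, folded B_def]
    and symB = second_fundamental_form_bilinear(2)[OF x, folded B_def]
    and bilG = G_metric(1)[OF p] and bilg = g_metric(1)[OF x]
    and quad = second_fundamental_form_vertical_quadratic[OF x, folded B_def]
  have "G (x, V x) (B (X + Z) (X + Z)) (0, Y) = G (x, V x) (B X X) (0, Y)
      + 2 * G (x, V x) (B X Z) (0, Y) + G (x, V x) (B Z Z) (0, Y)"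
    by (simp add: bilinear_ladd[OF bilB] bilinear_radd[OF bilB] bilinear_ladd[OF bilG] symB[of Z X])
  then show ?thesis
    unfolding B_def[symmetric] quad bilinear_ladd[OF bilg] bilinear_radd[OF bilg]
      g_metric(2)[OF x, of Z X]
    by (simp add: power2_eq_square field_simps)
qed

text \<open>
  \<open>T(V)\<close> collects exactly the coefficients of \<open>G(\<cdot>, Y\<^sup>v)\<close>, so pairing with \<open>Y\<close> recovers \<open>G(\<tau>(V), Y\<^sup>v)\<close>.
\<close>

lemma T_field_inner:
  assumes x: "x \<in> U"
  shows "g x (T_field \<alpha> \<beta> g V x) Y
    = G (x, V x) (tension g G (\<lambda>y. (y, V y)) x) (0, Y)"
proof -
  note bil = g_metric(1)[OF x]
  have "ver_part g (x, V x) (0, Y) = Y"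
    by (simp add: ver_part_def bilinear_lzero[OF bilinear_\<Gamma>[OF x]])
  moreover define \<tau> where "\<tau> = tension g G (\<lambda>y. (y, V y)) x"
  ultimately show ?thesis
    unfolding T_field_def Let_def \<tau>_def[symmetric]
      natural_metric_def[of \<alpha> \<beta> g "(x, V x)" \<tau> "(0, Y)"]
    by (simp add: bilinear_ladd[OF bil] bilinear_lmul[OF bil] bilinear_lzero[OF bil] bilinear_rzero[OF bil]
        g_metric(2)[OF x, of "V x" Y] hor_part_def)
qed

lemma T_field_inner_eq:
  assumes x: "x \<in> U"
  shows "g x (T_field \<alpha> \<beta> g V x) Y =
    (real DIM('b) * (- \<alpha> 1 1 - \<alpha>' 1 - \<alpha>' 3 - \<alpha>' 1) + (\<alpha>' 1 - \<beta>' 1 - \<beta>' 3)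
      + (\<alpha> 1 1 - \<beta> 1 1 - \<beta> 3 1)) * g x (V x) Y"
proof -
  define c1 where "c1 = (- \<alpha> 1 1 - \<alpha>' 1 - \<alpha>' 3 - \<alpha>' 1)"
  define c2 where "c2 = (\<alpha>' 1 - \<beta>' 1 - \<beta>' 3)"
  define c3 where "c3 = (\<alpha> 1 1 - \<beta> 1 1 - \<beta> 3 1)"
  have p: "(x, V x) \<in> U \<times> UNIV" using x by simp
  have lin: "linear (\<lambda>w. G (x, V x) w (0, Y))" using G_metric(1)[OF p] by (simp add: bilinear_def)
  have trace: "metric_trace g x (\<lambda>X Z. g x X A * g x Z C) = g x A C"
    "metric_trace g x (g x) = real DIM('b)" for A C
    by (rule metric_trace_inner; use g_metric[OF x] in blast)+
  have "g x (T_field \<alpha> \<beta> g V x) Y = metric_trace g x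
      (\<lambda>X Z. G (x, V x) (second_fundamental_form g G (\<lambda>y. (y, V y)) x X Z) (0, Y))"
    unfolding T_field_inner[OF x] tension_def metric_trace_def by (rule linear_sum[OF lin])
  also have "\<dots> = c1 * g x (V x) Y * metric_trace g x (g x)
      + c2 * g x (V x) Y * metric_trace g x (\<lambda>X Z. g x X (V x) * g x Z (V x))
      + c3 / 2 * (metric_trace g x (\<lambda>X Z. g x X (V x) * g x Z Y)
                  + metric_trace g x (\<lambda>X Z. g x X Y * g x Z (V x)))"
    unfolding second_fundamental_form_vertical[OF x] c1_def[symmetric] c2_def[symmetric]
      c3_def[symmetric] metric_trace_linear ..
  also have "\<dots> = (real DIM('b) * c1 + c2 + c3) * g x (V x) Y"
    unfolding trace unit[OF x] g_metric(2)[OF x, of Y] by (simp add: algebra_simps)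
  finally show ?thesis unfolding c1_def c2_def c3_def .
qed

lemma T_field_eq_0_iff:
  assumes x: "x \<in> U"
  shows "T_field \<alpha> \<beta> g V x = 0 \<longleftrightarrow>
    real DIM('b) * (- \<alpha> 1 1 - \<alpha>' 1 - \<alpha>' 3 - \<alpha>' 1) + (\<alpha>' 1 - \<beta>' 1 - \<beta>' 3)
      + (\<alpha> 1 1 - \<beta> 1 1 - \<beta> 3 1) = 0" (is "?T = 0 \<longleftrightarrow> ?c = 0")
proof
  assume "?T = 0"
  then show "?c = 0"
    using T_field_inner_eq[OF x, of "V x"] unit[OF x] bilinear_lzero[OF g_metric(1)[OF x]] by simp
next
  assume "?c = 0"
  then have "g x ?T ?T = 0" unfolding T_field_inner_eq[OF x] by simp
  then show "?T = 0" using g_metric(3)[OF x, of ?T] by fastforce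
qed

end

section \<open>Existence of a chart and the criterion\<close>

text \<open>
  The function \<open>r = (1 - |x|\<^sup>2)\<^bsup>-1/2\<^esup>\<close> satisfies \<open>D\<^sub>v r = \<langle>x, v\<rangle> r\<^sup>3\<close>, so one more derivative of \<open>r\<close> costs
  only products of functions already treated.
\<close>

lemma Ck_on_inverse_sqrt:
  "Ck_on k (ball 0 1) (\<lambda>x :: 'b::euclidean_space. inverse (sqrt (1 - x \<bullet> x)))"
proof (induction k)
  case 0
  have "1 - x \<bullet> x > 0" if "x \<in> ball 0 1" for x :: 'b
    using that by (simp add: dot_square_norm abs_square_less_1)
  then show ?case by (auto intro!: continuous_intros) (metis less_irrefl)
next
  case (Suc k)
  define r where "r x = inverse (sqrt (1 - x \<bullet> x))" for x :: 'b
  have der: "(r has_derivative (\<lambda>v. (x \<bullet> v) *\<^sub>R (r x *\<^sub>R (r x *\<^sub>R r x)))) (at x)"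
    if "x \<in> ball 0 1" for x
  proof -
    have pos: "1 - x \<bullet> x > 0" using that by (simp add: dot_square_norm abs_square_less_1)
    show ?thesis
      unfolding r_def using pos
      by (auto intro!: derivative_eq_intros simp: inner_commute field_simps)
  qed
  have "Ck_on k (ball 0 1) (\<lambda>x. frechet_derivative r (at x) v)" for v
  proof (rule Ck_on_cong[OF open_ball])
    have "linear (\<lambda>x. x \<bullet> v)" by (intro bounded_linear.linear bounded_linear_inner_left)
    from Ck_on_linear[OF open_ball this Ck_on_ident]
    show "Ck_on k (ball 0 1) (\<lambda>x. (x \<bullet> v) *\<^sub>R (r x *\<^sub>R (r x *\<^sub>R r x)))"
      using Suc.IH unfolding r_def[symmetric] by (intro Ck_on_scaleR open_ball)
    show "(x \<bullet> v) *\<^sub>R (r x *\<^sub>R (r x *\<^sub>R r x)) = frechet_derivative r (at x) v"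
      if "x \<in> ball 0 1" for x
      using frechet_derivative_at[OF der[OF that]] by metis
  qed
  moreover have "r differentiable (at x)" if "x \<in> ball 0 1" for x
    using der[OF that] by (rule differentiableI)
  ultimately show ?case unfolding r_def[symmetric] by simp
qed

lemma smooth_on_sqrt_ball:
  "smooth_on (ball 0 1) (\<lambda>x :: 'b::euclidean_space. sqrt (1 - x \<bullet> x))"
  unfolding smooth_on_def
proof
  fix k
  define s where "s x = sqrt (1 - x \<bullet> x)" for x :: 'b
  have der: "(s has_derivative (\<lambda>v. - (x \<bullet> v) *\<^sub>R inverse (sqrt (1 - x \<bullet> x)))) (at x)"
    if "x \<in> ball 0 1" for x
  proof -
    have pos: "1 - x \<bullet> x > 0" using that by (simp add: dot_square_norm abs_square_less_1)
    show ?thesis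
      unfolding s_def using pos
      by (auto intro!: derivative_eq_intros simp: inner_commute field_simps)
  qed
  have "Ck_on (Suc k) (ball 0 1) s"
    unfolding Ck_on.simps(2)
  proof (intro conjI ballI allI)
    show "s differentiable (at x)" if "x \<in> ball 0 1" for x
      using der[of x] that differentiableI by auto
    show "Ck_on k (ball 0 1) (\<lambda>x. frechet_derivative s (at x) v)" for v
    proof (rule Ck_on_cong[OF open_ball])
      have "linear (\<lambda>x. - (x \<bullet> v))"
        by (intro bounded_linear.linear bounded_linear_minus bounded_linear_inner_left)
      from Ck_on_linear[OF open_ball this Ck_on_ident]
      show "Ck_on k (ball 0 1) (\<lambda>x. - (x \<bullet> v) *\<^sub>R inverse (sqrt (1 - x \<bullet> x)))"
        by (intro Ck_on_scaleR open_ball Ck_on_inverse_sqrt)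
      show "- (x \<bullet> v) *\<^sub>R inverse (sqrt (1 - x \<bullet> x)) = frechet_derivative s (at x) v"
        if "x \<in> ball 0 1" for x
        using frechet_derivative_at[OF der[OF that]] by metis
    qed
  qed
  then have "Ck_on k (ball 0 1) s" by (rule Ck_on_SucD)
  then show "Ck_on k (ball 0 1) (\<lambda>x :: 'b. sqrt (1 - x \<bullet> x))" by (simp add: s_def[abs_def])
qed

text \<open>
  An open hemisphere as the graph of \<open>sqrt (1 - |x|\<^sup>2)\<close> over the unit ball of its equatorial hyperplane,
  identified with \<open>'b\<close> by a linear isometry. The inverse chart is the restriction of a linear map, which
  makes both the homeomorphism and the injectivity of the derivative immediate.
\<close>

lemma sphere_has_local_param:
  assumes dims: "DIM('a::euclidean_space) = DIM('b::euclidean_space) + 1"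
  obtains U :: "'b::euclidean_space set" and \<psi> :: "'b \<Rightarrow> 'a::euclidean_space" where "U \<noteq> {}" "local_param (sphere 0 1) U \<psi>"
proof -
  obtain e :: 'a where "e \<in> Basis" using nonempty_Basis by blast
  then have ee: "e \<bullet> e = 1" and e0: "e \<noteq> 0" by auto
  define S where "S = {v. e \<bullet> v = 0}"
  have "subspace S" "dim (UNIV :: 'b set) = dim S"
    using dim_hyperplane[OF e0] dims by (simp_all add: S_def subspace_hyperplane)
  then obtain L N where L: "linear (L :: 'b \<Rightarrow> 'a)" "range L = S" "\<And>x. norm (L x) = norm x"
    and N: "linear N" "\<And>x. N (L x) = x" "\<And>y. y \<in> S \<Longrightarrow> L (N y) = y"
    using isometries_subspaces[OF subspace_UNIV, of S] by (metis UNIV_I)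
  define U where "U = ball (0::'b) 1"
  define \<psi> where "\<psi> x = L x + sqrt (1 - x \<bullet> x) *\<^sub>R e" for x
  define \<kappa> where "\<kappa> p = N (p - (e \<bullet> p) *\<^sub>R e)" for p
  have pos: "1 - x \<bullet> x > 0" if "x \<in> U" for x
    using that by (simp add: U_def dot_square_norm abs_square_less_1)
  have eL: "e \<bullet> L x = 0" for x using L(2) by (auto simp: S_def)
  have e\<psi>: "e \<bullet> \<psi> x = sqrt (1 - x \<bullet> x)" for x
    by (simp add: \<psi>_def inner_add_right eL ee)
  have \<kappa>\<psi>: "\<kappa> (\<psi> x) = x" for x
    by (simp add: \<kappa>_def e\<psi>) (simp add: \<psi>_def N)
  have lin\<kappa>: "linear \<kappa>"
  proof -
    have "linear (\<lambda>p. p - (e \<bullet> p) *\<^sub>R e)"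
      by (rule linearI) (simp_all add: inner_add_right algebra_simps)
    from linear_compose[OF this N(1)] show ?thesis by (simp add: \<kappa>_def[abs_def] o_def)
  qed
  have smooth: "smooth_on U \<psi>"
    using smooth_on_sqrt_ball[where 'b = 'b] unfolding smooth_on_def \<psi>_def[abs_def] U_def
    by (intro allI Ck_on_add Ck_on_linear[OF _ L(1)] Ck_on_scaleR Ck_on_ident Ck_on_const) auto
  have image: "\<psi> ` U = sphere 0 1 \<inter> {p. e \<bullet> p > 0}"
  proof (intro equalityI subsetI)
    fix p assume "p \<in> \<psi> ` U"
    then obtain x where x: "x \<in> U" "p = \<psi> x" by auto
    have "\<psi> x \<bullet> \<psi> x = L x \<bullet> L x + sqrt (1 - x \<bullet> x) * sqrt (1 - x \<bullet> x)"
      using eL[of x] by (simp add: \<psi>_def inner_add_left inner_add_right ee inner_commute[of "L x" e])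
    also have "\<dots> = 1"
      using pos[OF x(1)] L(3)[of x] by (simp add: dot_square_norm)
    finally show "p \<in> sphere 0 1 \<inter> {p. e \<bullet> p > 0}"
      using pos[OF x(1)] by (simp add: x e\<psi> norm_eq_1)
  next
    fix p assume p: "p \<in> sphere 0 1 \<inter> {p. e \<bullet> p > 0}"
    define y where "y = p - (e \<bullet> p) *\<^sub>R e"
    have "y \<in> S" by (simp add: S_def y_def inner_diff_right ee)
    then have Ly: "L (N y) = y" by (rule N)
    have "N y \<bullet> N y = y \<bullet> y" using L(3)[of "N y"] by (simp add: Ly dot_square_norm)
    also have "\<dots> = 1 - (e \<bullet> p)\<^sup>2"
      using p by (simp add: y_def inner_diff_left inner_diff_right ee inner_commute[of p e]
          norm_eq_1 power2_eq_square)
    finally have yy: "N y \<bullet> N y = 1 - (e \<bullet> p)\<^sup>2" .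
    then have "norm (N y) < 1"
      using p by (simp add: norm_lt_square)
    moreover have "\<psi> (N y) = p" using p by (simp add: \<psi>_def Ly yy) (simp add: y_def)
    ultimately show "p \<in> \<psi> ` U" by (auto simp: U_def)
  qed
  have "local_param (sphere 0 1) U \<psi>"
    unfolding local_param_def
  proof (intro conjI ballI exI)
    show "open U" by (simp add: U_def)
    show "smooth_on U \<psi>" by (rule smooth)
    show "openin (top_of_set (sphere 0 1)) (\<psi> ` U)"
      unfolding image by (intro openin_open_Int open_halfspace_gt)
    show "homeomorphism U (\<psi> ` U) \<psi> \<kappa>"
      unfolding homeomorphism_def
      using smooth_on_continuous_on[OF smooth] lin\<kappa>
      by (auto simp: \<kappa>\<psi> linear_continuous_on linear_conv_bounded_linear image_image)
    fix x assume x: "x \<in> U"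
    have "(\<psi> has_derivative (\<lambda>v. dd v \<psi> x)) (at x)"
      using smooth_on_differentiable[OF smooth x] by (rule has_derivative_dd)
    \<comment> \<open>The derivative of the identity \<open>\<kappa> \<circ> \<psi>\<close> shows that the derivative of \<open>\<psi>\<close> has a left inverse.\<close>
    then have "((\<lambda>x. \<kappa> (\<psi> x)) has_derivative (\<lambda>v. \<kappa> (dd v \<psi> x))) (at x)"
      using lin\<kappa> by (intro bounded_linear.has_derivative[of \<kappa>]) (simp_all add: linear_conv_bounded_linear)
    then have "((\<lambda>x. x) has_derivative (\<lambda>v. \<kappa> (dd v \<psi> x))) (at x)" by (simp add: \<kappa>\<psi>)
    then have "\<kappa> (dd v \<psi> x) = v" for v
      using has_derivative_unique[OF _ has_derivative_ident, of "\<lambda>v. \<kappa> (dd v \<psi> x)" x] by metis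
    then show "inj (frechet_derivative \<psi> (at x))"
      by (intro inj_on_inverseI[of _ \<kappa>]) (simp add: dd_def)
  qed
  moreover have "U \<noteq> {}" by (simp add: U_def)
  ultimately show ?thesis using that by blast
qed

text \<open>
  Away from the boundary of the half line one-sided derivatives are derivatives.
\<close>

lemma smooth_half_line_has_deriv:
  assumes "smooth_half_line f" "t > 0"
  shows "(f has_real_derivative deriv f t) (at t)"
proof -
  obtain d where d: "d 0 = f" "\<And>k t. t \<ge> 0 \<Longrightarrow>
      (d k has_real_derivative d (Suc k) t) (at t within {0..})"
    using assms(1) unfolding smooth_half_line_def by blast
  have "(f has_real_derivative d 1 t) (at t within {0..})" using d(2)[of t 0] d(1) assms(2) by simp
  moreover have "at t within {0..} = at t" using assms(2) by (intro at_within_interior) simp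
  ultimately show ?thesis by (metis DERIV_imp_deriv)
qed

lemma hopf_chart_local_field:
  fixes \<xi> :: "'a::euclidean_space \<Rightarrow> 'a" and \<psi> :: "'b::euclidean_space \<Rightarrow> 'a"
  assumes dims: "DIM('a) = DIM('b) + 1" and hopf: "hopf_field TYPE('b) \<xi>"
    and chart: "local_param (sphere 0 1) U \<psi>"
  shows "hopf_chart U \<psi> (local_field \<psi> \<xi>)"
proof -
  interpret sphere_chart U \<psi> by unfold_locales (fact chart dims)+
  have sm: "smooth_vector_field TYPE('b) (sphere 0 1) \<xi>"
    and kill: "killing_field TYPE('b) (sphere 0 1) \<xi>"
    using hopf unfolding hopf_field_def killing_field_def by auto
  have V: "dd (local_field \<psi> \<xi> x) \<psi> x = \<xi> (\<psi> x)" if x: "x \<in> U" for x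
  proof -
    have "\<xi> (\<psi> x) \<in> range (\<lambda>v. dd v \<psi> x)"
      using sm chart x unfolding smooth_vector_field_def dd_def by blast
    then have "\<exists>!w. dd w \<psi> x = \<xi> (\<psi> x)" using inj[OF x] by (auto simp: inj_def)
    from theI'[OF this] show ?thesis unfolding local_field_def by (simp add: dd_def)
  qed
  show ?thesis
  proof unfold_locales
    show "smooth_on U (local_field \<psi> \<xi>)"
      using sm chart unfolding smooth_vector_field_def by blast
    fix x assume x: "x \<in> U"
    have "norm (\<xi> (\<psi> x)) = 1"
      using hopf on_sphere[OF x] unfolding hopf_field_def by (simp add: norm_eq_1)
    then show "g x (local_field \<psi> \<xi> x) (local_field \<psi> \<xi> x) = 1"
      by (simp add: g_eq V[OF x] norm_eq_1)
    show "metric_deriv g x (local_field \<psi> \<xi> x) X Y + g x (dd X (local_field \<psi> \<xi>) x) Y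
        + g x X (dd Y (local_field \<psi> \<xi>) x) = 0" for X Y
      using kill chart x unfolding killing_field_def dd_def by blast
  qed
qed

theorem corollary6:
  fixes m :: nat
    and \<alpha> \<beta> :: "nat \<Rightarrow> real \<Rightarrow> real"
    and \<xi> :: "'a::euclidean_space \<Rightarrow> 'a"
  assumes "DIM('a) = 2 * m + 2"
    and "DIM('b::euclidean_space) = 2 * m + 1"
    and "riemannian_natural TYPE('b) (sphere (0::'a) 1) \<alpha> \<beta>"
    and "hopf_field TYPE('b) \<xi>"
  shows "X_harmonic TYPE('b) (sphere (0::'a) 1) \<alpha> \<beta> \<xi> \<longleftrightarrow>
    2 * real m * (\<alpha> 1 1 + deriv (\<alpha> 1) 1)
    + deriv (\<lambda>t. 2 * real m * (\<alpha> 1 t + \<alpha> 3 t) + phi \<alpha> \<beta> 1 t + phi \<alpha> \<beta> 3 t) 1 = 0"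
    (is "_ \<longleftrightarrow> ?R = 0")
proof -
  have dims: "DIM('a) = DIM('b) + 1" using assms(1,2) by simp
  define \<alpha>' where "\<alpha>' i = deriv (\<alpha> i) 1" for i
  define \<beta>' where "\<beta>' i = deriv (\<beta> i) 1" for i
  have deriv: "(\<alpha> i has_real_derivative \<alpha>' i) (at 1)" "(\<beta> i has_real_derivative \<beta>' i) (at 1)"
    if "i \<in> {1, 2, 3}" for i
    using assms(3) that unfolding riemannian_natural_def \<alpha>'_def \<beta>'_def
    by (auto intro!: smooth_half_line_has_deriv)
  have "((\<lambda>t. 2 * real m * (\<alpha> 1 t + \<alpha> 3 t) + phi \<alpha> \<beta> 1 t + phi \<alpha> \<beta> 3 t) has_real_derivative
      2 * real m * (\<alpha>' 1 + \<alpha>' 3) + (\<alpha>' 1 + (\<beta> 1 1 + \<beta>' 1)) + (\<alpha>' 3 + (\<beta> 3 1 + \<beta>' 3))) (at 1)"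
    unfolding phi_def using deriv[of 1] deriv[of 3] by (auto intro!: derivative_eq_intros)
  then have R: "?R = 2 * real m * (\<alpha> 1 1 + \<alpha>' 1) + (2 * real m * (\<alpha>' 1 + \<alpha>' 3)
      + (\<alpha>' 1 + (\<beta> 1 1 + \<beta>' 1)) + (\<alpha>' 3 + (\<beta> 3 1 + \<beta>' 3)))"
    by (simp only: DERIV_imp_deriv \<alpha>'_def[symmetric])
  have T: "T_field \<alpha> \<beta> (induced_metric \<psi>) (local_field \<psi> \<xi>) x = 0 \<longleftrightarrow> ?R = 0"
    if chart: "local_param (sphere 0 1) U \<psi>" and x: "x \<in> U" for U and \<psi> :: "'b \<Rightarrow> 'a" and x
  proof -
    interpret hopf_chart U \<psi> "local_field \<psi> \<xi>"
      using dims assms(4) chart by (rule hopf_chart_local_field)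
    interpret natural_hopf_chart U \<psi> "local_field \<psi> \<xi>" \<alpha> \<beta> \<alpha>' \<beta>'
      using assms(3) chart deriv unfolding riemannian_natural_def by unfold_locales blast+
    show ?thesis
      unfolding T_field_eq_0_iff[OF x] R assms(2) by (simp add: algebra_simps) linarith
  qed
  obtain U :: "'b set" and \<psi> :: "'b \<Rightarrow> 'a" where "U \<noteq> {}" "local_param (sphere 0 1) U \<psi>"
    using sphere_has_local_param[OF dims] .
  then show ?thesis using T unfolding X_harmonic_def by blast
qed

end
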